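(* Let the weak constraint matrix $A_h$ and vector $\mathbf b_h$, the matrix $H_h$, the vector $\mathbf k_h$, the metric matrix $W_h$ and the recovered update $\widetilde P_h:X_h\to X_h$, $\widetilde P_h\mathbf z_h=H_h\mathbf z_h+\mathbf k_h$, be as defined in the context. Then for every $\mathbf z_h\in X_h$ $$A_h\widetilde P_h\mathbf z_h-\mathbf b_h=A_hH_h\mathbf z_h+A_h\mathbf k_h-\mathbf b_h,$$ $$\widetilde P_h(\widetilde P_h\mathbf z_h)-\widetilde P_h\mathbf z_h=(H_h^2-H_h)\mathbf z_h+H_h\mathbf k_h.$$ Thus feasibility of every output (i.e. $A_h\widetilde P_h\mathbf z_h=\mathbf b_h$ for all $\mathbf z_h\in X_h$) requires $A_hH_h=0$ and $A_h\mathbf k_h=\mathbf b_h$. Idempotence (i.e. $\widetilde P_h\circ\widetilde P_h=\widetilde P_h$ on $X_h$) requires $H_h^2=H_h$ and $H_h\mathbf k_h=0$. These conditions alone do not prove orthogonality in $W_h$.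
   Context: **Mesh and spaces.** $\mathcal M_h\subset\mathbb R^3$ is a connected, shape-regular triangulated surface with vertices $V_1,\dots,V_{N_v}$, approximating a compact connected oriented $C^3$ two-dimensional surface $\mathcal M\subset\mathbb R^3$ without boundary. $S_h$ is the space of continuous piecewise linear functions on $\mathcal M_h$, with nodal basis $\{\psi_i\}$. Let $N_t\ge2$, $\tau=1/N_t$, $t_j=j\tau$, $w_0=w_{N_t}=\tau/2$ and $w_j=\tau$ otherwise. $S_\tau$ is the space of continuous piecewise linear functions on the time grid, with nodal basis $\{\phi_j\}_{j=0}^{N_t}$, and $Q_h=S_\tau\otimes S_h$; write $u_h=\sum_j u_{h,j}\phi_j$ with $u_{h,j}\in S_h$. $(\cdot,\cdot)_{\mathcal M_h}$ is the $L^2(\mathcal M_h)$ inner product and $\nabla_{g_h}$ the elementwise surface gradient. $\rho_{0,h},\rho_{1,h}\in S_h$ are given discrete endpoint densities, each of unit mass on $\mathcal M_h$. **Recovered derivatives.** $G_\tau$ acts on nodal values in time by $(G_\tau u)_0=(-3u_0+4u_1-u_2)/(2\tau)$, $(G_\tau u)_j=(u_{j+1}-u_{j-1})/(2\tau)$ for $1\le j<N_t$, $(G_\tau u)_{N_t}=(3u_{N_t}-4u_{N_t-1}+u_{N_t-2})/(2\tau)$. For the spatial recovery, at each vertex $V_i$ a fixed connected vertex patch is projected onto a local plane, and in local planar coordinates centred at $V_i$ one fits by least squares a quadratic parametrization $r_i:\mathbb R^2\to\mathbb R^3$ to the patch vertices and a quadratic polynomial $q_i$ to the values of $u_h$; the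 quadratic design matrix has rank six and $J_i=Dr_i(0)$ has rank two. Then $(G_hu_h)(V_i)=J_i(J_i^\top J_i)^{-1}\nabla q_i(0)\in\mathbb R^3$, extended by nodal interpolation; $B_x,B_y,B_z$ are the matrices of the three components of $G_h$. For a vector field, $G_h\cdot\mathbf m_h=B_xm_x+B_ym_y+B_zm_z$ (nodally, then interpolated). Let $\mathbf n_i$ be a unit normal to the range of $J_i$ and $\Pi_i=I-\mathbf n_i\mathbf n_i^\top$. $X_h$ is the space of pairs $\mathbf z_h=(\rho_h,\mathbf m_h)$ with $\rho_h\in Q_h$, $\mathbf m_h\in (Q_h)^3$ and nodal values $\mathbf m_{h,ji}\in\mathbf n_i^\perp$, represented by scalar and two-component nodal tangent coordinates. Put $\mathbb G_h\varphi_h=(G_\tau\varphi_h,G_h\varphi_h)\in X_h$. **Metric.** $W_h$ is the matrix of the metric on $X_h$ given by $$\|\mathbf z_h\|_h^2=\sum_{j=0}^{N_t}\sum_{i=1}^{N_v}w_j\Bigl(\int_{\mathcal M_h}\psi_i\,d\sigma_h\Bigr)\bigl(|\rho_{h,ji}|^2+|\mathbf m_{h,ji}|^2\bigr),$$ where the subscript $ji$ denotes the nodal value at $(t_j,V_i)$. Orthogonality in $W_h$ refers to $\widetilde P_h$ being an orthogonal projection in this metric, the comparison being the exact $W_h$-orthogonal projection onto $\mathcal C_h=\{\mathbf z_h\in X_h:A_h\mathbf z_h=\mathbf b_h\}$ (when this set is nonempty), with $A_h,\mathbf b_h$ as below. **Poisson problem and recovered update.** $V_h=\{v_h\in Q_h:\sum_jw_j(v_{h,j},1)_{\mathcal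 M_h}=0\}$. For $u_h,v_h\in Q_h$, $$\mathfrak a_h(u_h,v_h)=\sum_{j=1}^{N_t}\tau\Bigl(\tfrac{u_{h,j}-u_{h,j-1}}\tau,\tfrac{v_{h,j}-v_{h,j-1}}\tau\Bigr)_{\mathcal M_h}+\sum_{j=0}^{N_t}w_j(\nabla_{g_h}u_{h,j},\nabla_{g_h}v_{h,j})_{\mathcal M_h},$$ which is positive definite on $V_h$. For $\mathbf z_h\in X_h$, $$\ell_h(\mathbf z_h;v_h)=\sum_jw_j\bigl(G_\tau\rho_{h,j}+G_h\cdot\mathbf m_{h,j}+b_{h,j}(\mathbf z_h),v_{h,j}\bigr)_{\mathcal M_h},$$ with $b_{h,0}=-2(\rho_{0,h}-\rho_{h,0})/\tau$, $b_{h,N_t}=2(\rho_{1,h}-\rho_{h,N_t})/\tau$, $b_{h,j}=0$ otherwise (here $\rho_{h,0},\rho_{h,N_t}$ are the first and last time layers of $\rho_h$). $\mathcal R_h$ is the affine map replacing the two endpoint density layers by $\rho_{0,h},\rho_{1,h}$ and projecting each nodal momentum by $\Pi_i$. The recovered update is $\widetilde P_h\mathbf z_h=\mathcal R_h(\mathbf z_h+\mathbb G_h\varphi_h)$, where $\varphi_h\in V_h$ is the exact solution of $\mathfrak a_h(\varphi_h,v_h)=\ell_h(\mathbf z_h;v_h)$ for all $v_h\in V_h$. **Matrix form.** In coordinates on $V_h$ let $\mathscr L_h$ be the positive definite matrix of $\mathfrak a_h$, write the load vector of $\ell_h(\mathbf z_h;\cdot)|_{V_h}$ as $D_h\mathbf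 z_h+\mathbf c_h$ with $\mathbf c_h$ the fixed affine part, let $\mathscr G_h$ be the matrix of $\mathbb G_h$, and write $\mathcal R_h\mathbf w=R_h\mathbf w+\mathbf r_h$ with $R_h$ linear. Set $U_h=I+\mathscr G_h\mathscr L_h^{-1}D_h$, $\mathbf q_h=\mathscr G_h\mathscr L_h^{-1}\mathbf c_h$, $H_h=R_hU_h$, $\mathbf k_h=R_h\mathbf q_h+\mathbf r_h$, so that $\widetilde P_h\mathbf z_h=H_h\mathbf z_h+\mathbf k_h$. **Weak constraint matrix.** $A_h\mathbf z_h=\mathbf b_h$ denotes the linear system consisting of the equations $$\int_0^1\!\int_{\mathcal M_h}(\rho_h\partial_tv_h+\mathbf m_h\cdot\nabla_{g_h}v_h)\,d\sigma_h\,dt=(\rho_{1,h},v_{h,N_t})_{\mathcal M_h}-(\rho_{0,h},v_{h,0})_{\mathcal M_h}$$ for all tensor-product basis functions $v_h=\phi_j\psi_i$, together with the endpoint coefficient equations $\rho_{h,0}=\rho_{0,h}$, $\rho_{h,N_t}=\rho_{1,h}$. *)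

theory Defs
  imports "HOL-Analysis.Analysis"
begin

section \<open>Discretisation data\<close>

text \<open>
  The vertices are indexed by the finite type \<open>'v\<close>, the time levels by the finite type \<open>'t\<close>
  (enumerated by \<^term>\<open>node\<close>), and a basis of the space \<open>V_h\<close> by the finite type \<open>'b\<close>.
  An element of \<open>S_h\<close> is stored as its vector of nodal values \<open>real^'v\<close>, an element of \<open>Q_h\<close>
  as the array \<open>u $ t $ i\<close> of type \<open>real^'v^'t\<close>; the functions themselves are
  \<open>S_fun\<close> and \<open>Q_fun\<close> below.
\<close>

record ('v::finite, 't::finite, 'b) ot_data =
  vtx    :: "'v \<Rightarrow> real^3"
  tri    :: "('v \<times> 'v \<times> 'v) set"           \<comment> \<open>each triangle once, with some ordering of its vertices\<close>
  shape  :: real                              \<comment> \<open>shape-regularity constant\<close>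
  surf   :: "(real^3) set"                    \<comment> \<open>the surface \<open>\<M>\<close> approximated by the mesh\<close>
  orient :: "real^3 \<Rightarrow> real^3"               \<comment> \<open>its orienting unit normal field\<close>
  tol    :: real                              \<comment> \<open>distance within which the mesh approximates \<open>\<M>\<close>\<close>
  Nt     :: nat
  node   :: "nat \<Rightarrow> 't"
  patch  :: "'v \<Rightarrow> 'v set"
  frame  :: "'v \<Rightarrow> 2 \<Rightarrow> real^3"             \<comment> \<open>orthonormal basis of the local projection plane\<close>
  nrm    :: "'v \<Rightarrow> real^3"                   \<comment> \<open>\<open>n_i\<close>\<close>
  tb     :: "'v \<Rightarrow> 2 \<Rightarrow> real^3"             \<comment> \<open>basis of the orthogonal complement of \<open>n_i\<close>\<close>
  vb     :: "'b \<Rightarrow> real^'v^'t"               \<comment> \<open>basis of \<open>V_h\<close>\<close>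
  rho0   :: "real^'v"
  rho1   :: "real^'v"

type_synonym ('v, 't) field = "(real^'v^'t) \<times> (real^3^'v^'t)"

section \<open>The surface and the triangulated surface\<close>

primrec Ck_on :: "nat \<Rightarrow> (real^3 \<Rightarrow> real) \<Rightarrow> (real^3) set \<Rightarrow> bool" where
  "Ck_on 0 f U \<longleftrightarrow> continuous_on U f"
| "Ck_on (Suc k) f U \<longleftrightarrow> f differentiable_on U \<and>
     (\<forall>c. Ck_on k (\<lambda>x. frechet_derivative f (at x) (axis c 1)) U)"

text \<open>
  A closed oriented hypersurface of class \<open>C\<^sup>3\<close>: locally a regular zero set of a \<open>C\<^sup>3\<close> function
  whose gradient is a positive multiple of the orienting normal.
\<close>
definition oriented_C3_surface :: "(real^3) set \<Rightarrow> (real^3 \<Rightarrow> real^3) \<Rightarrow> bool" where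
  "oriented_C3_surface M \<nu> \<longleftrightarrow>
     compact M \<and> connected M \<and> M \<noteq> {} \<and> continuous_on M \<nu> \<and> (\<forall>p\<in>M. norm (\<nu> p) = 1) \<and>
     (\<forall>p\<in>M. \<exists>U f. open U \<and> p \<in> U \<and> Ck_on 3 f U \<and> M \<inter> U = {x \<in> U. f x = 0} \<and>
        (\<forall>x\<in>M \<inter> U. \<exists>c>0. (f has_derivative (\<lambda>h. c * (\<nu> x \<bullet> h))) (at x)))"

definition verts :: "'v \<times> 'v \<times> 'v \<Rightarrow> 'v set" where
  "verts T = (case T of (a, b, c) \<Rightarrow> {a, b, c})"

definition cell :: "('v::finite, 't::finite, 'b) ot_data \<Rightarrow> 'v \<times> 'v \<times> 'v \<Rightarrow> (real^3) set" where
  "cell S T = convex hull (vtx S ` verts T)"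

definition mesh :: "('v::finite, 't::finite, 'b) ot_data \<Rightarrow> (real^3) set" where
  "mesh S = (\<Union>T\<in>tri S. cell S T)"

definition adjacent :: "('v::finite, 't::finite, 'b) ot_data \<Rightarrow> ('v \<times> 'v) set" where
  "adjacent S = {(k, l). k \<noteq> l \<and> (\<exists>T\<in>tri S. k \<in> verts T \<and> l \<in> verts T)}"

text \<open>
  Every edge lies in exactly two triangles and the triangles around a vertex are connected through
  common edges, so the mesh is a surface without boundary. Shape regularity: each triangle contains
  a disc (in its own plane) of radius at least its diameter divided by \<^term>\<open>shape S\<close>.
\<close>
definition triangulated_surface :: "('v::finite, 't::finite, 'b) ot_data \<Rightarrow> bool" where
  "triangulated_surface S \<longleftrightarrow>
     inj (vtx S) \<and> inj_on verts (tri S) \<and>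
     (\<forall>i. \<exists>T\<in>tri S. i \<in> verts T) \<and>
     (\<forall>T\<in>tri S. \<not> collinear (vtx S ` verts T)) \<and>
     (\<forall>T\<in>tri S. \<forall>T'\<in>tri S. cell S T \<inter> cell S T' = convex hull (vtx S ` (verts T \<inter> verts T'))) \<and>
     (\<forall>(k, l)\<in>adjacent S. card {T \<in> tri S. k \<in> verts T \<and> l \<in> verts T} = 2) \<and>
     (\<forall>i. \<forall>T\<in>tri S. \<forall>T'\<in>tri S. i \<in> verts T \<and> i \<in> verts T' \<longrightarrow>
        (T, T') \<in> {(X, Y). X \<in> tri S \<and> Y \<in> tri S \<and> i \<in> verts X \<and> i \<in> verts Y \<and>
                    card (verts X \<inter> verts Y) = 2}\<^sup>*) \<and>
     connected (mesh S) \<and>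
     shape S > 0 \<and>
     (\<forall>T\<in>tri S. \<exists>x\<in>cell S T.
        ball x (diameter (cell S T) / shape S) \<inter> affine hull (vtx S ` verts T) \<subseteq> cell S T)"

definition approximates_surface :: "('v::finite, 't::finite, 'b) ot_data \<Rightarrow> bool" where
  "approximates_surface S \<longleftrightarrow> oriented_C3_surface (surf S) (orient S) \<and>
     (\<forall>x\<in>mesh S. infdist x (surf S) \<le> tol S) \<and> (\<forall>y\<in>surf S. infdist y (mesh S) \<le> tol S)"

section \<open>Surface integration and the surface gradient\<close>

text \<open>The surface measure on a triangle, through the affine parametrisation by the unit simplex.\<close>
definition cell_integral ::
  "('v::finite, 't::finite, 'b) ot_data \<Rightarrow> 'v \<times> 'v \<times> 'v \<Rightarrow> (real^3 \<Rightarrow> real) \<Rightarrow> real" where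
  "cell_integral S T f = (case T of (a, b, c) \<Rightarrow>
     norm (cross3 (vtx S b - vtx S a) (vtx S c - vtx S a)) *
     (LINT p:{(x, y). 0 \<le> x \<and> 0 \<le> y \<and> x + y \<le> (1::real)}|lborel.
        f (vtx S a + fst p *\<^sub>R (vtx S b - vtx S a) + snd p *\<^sub>R (vtx S c - vtx S a))))"

text \<open>The integrand may depend on the triangle, as elementwise gradients do.\<close>
definition mesh_integral ::
  "('v::finite, 't::finite, 'b) ot_data \<Rightarrow> ('v \<times> 'v \<times> 'v \<Rightarrow> real^3 \<Rightarrow> real) \<Rightarrow> real" where
  "mesh_integral S F = (\<Sum>T\<in>tri S. cell_integral S T (F T))"

definition L2 ::
  "('v::finite, 't::finite, 'b) ot_data \<Rightarrow> (real^3 \<Rightarrow> real) \<Rightarrow> (real^3 \<Rightarrow> real) \<Rightarrow> real" where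
  "L2 S f g = mesh_integral S (\<lambda>T x. f x * g x)"

text \<open>
  The derivative of \<open>f\<close> within a triangle determines its gradient only up to a normal component;
  the surface gradient is the representative in the plane of the triangle.
\<close>
definition surf_grad ::
  "('v::finite, 't::finite, 'b) ot_data \<Rightarrow> 'v \<times> 'v \<times> 'v \<Rightarrow> (real^3 \<Rightarrow> real) \<Rightarrow> real^3 \<Rightarrow> real^3" where
  "surf_grad S T f x = (THE g.
     g \<in> span {vtx S k - vtx S l |k l. k \<in> verts T \<and> l \<in> verts T} \<and>
     (f has_derivative (\<lambda>h. g \<bullet> h)) (at x within cell S T))"

section \<open>Finite element spaces\<close>

text \<open>
  Elements of \<open>S_h\<close> and \<open>S_\<tau>\<close> are made total functions by the value 0 outside of the mesh and
  outside of the unit interval.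
\<close>
definition S_h :: "('v::finite, 't::finite, 'b) ot_data \<Rightarrow> (real^3 \<Rightarrow> real) set" where
  "S_h S = {f. continuous_on (mesh S) f \<and> (\<forall>x. x \<notin> mesh S \<longrightarrow> f x = 0) \<and>
     (\<forall>T\<in>tri S. \<exists>c g. \<forall>x\<in>cell S T. f x = c + g \<bullet> x)}"

definition psi :: "('v::finite, 't::finite, 'b) ot_data \<Rightarrow> 'v \<Rightarrow> real^3 \<Rightarrow> real" where
  "psi S i = (THE f. f \<in> S_h S \<and> (\<forall>k. f (vtx S k) = (if k = i then 1 else 0)))"

definition tau :: "('v::finite, 't::finite, 'b) ot_data \<Rightarrow> real" where
  "tau S = 1 / real (Nt S)"

definition tpt :: "('v::finite, 't::finite, 'b) ot_data \<Rightarrow> nat \<Rightarrow> real" where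
  "tpt S j = real j * tau S"

definition wt :: "('v::finite, 't::finite, 'b) ot_data \<Rightarrow> nat \<Rightarrow> real" where
  "wt S j = (if j = 0 \<or> j = Nt S then tau S / 2 else tau S)"

definition S_tau :: "('v::finite, 't::finite, 'b) ot_data \<Rightarrow> (real \<Rightarrow> real) set" where
  "S_tau S = {f. continuous_on {0..1} f \<and> (\<forall>t. t \<notin> {0..1} \<longrightarrow> f t = 0) \<and>
     (\<forall>j\<in>{1..Nt S}. \<exists>c d. \<forall>t\<in>{tpt S (j - 1)..tpt S j}. f t = c + d * t)}"

definition phi :: "('v::finite, 't::finite, 'b) ot_data \<Rightarrow> nat \<Rightarrow> real \<Rightarrow> real" where
  "phi S j = (THE f. f \<in> S_tau S \<and> (\<forall>k\<le>Nt S. f (tpt S k) = (if k = j then 1 else 0)))"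

definition layer :: "('v::finite, 't::finite, 'b) ot_data \<Rightarrow> 'a^'t \<Rightarrow> nat \<Rightarrow> 'a" where
  "layer S u j = u $ node S j"

definition tidx :: "('v::finite, 't::finite, 'b) ot_data \<Rightarrow> 't \<Rightarrow> nat" where
  "tidx S = the_inv_into {0..Nt S} (node S)"

definition S_fun :: "('v::finite, 't::finite, 'b) ot_data \<Rightarrow> real^'v \<Rightarrow> real^3 \<Rightarrow> real" where
  "S_fun S u x = (\<Sum>i\<in>UNIV. u $ i * psi S i x)"

definition Q_fun :: "('v::finite, 't::finite, 'b) ot_data \<Rightarrow> real^'v^'t \<Rightarrow> real \<Rightarrow> real^3 \<Rightarrow> real" where
  "Q_fun S u t x = (\<Sum>j=0..Nt S. phi S j t * S_fun S (layer S u j) x)"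

definition Q3_fun :: "('v::finite, 't::finite, 'b) ot_data \<Rightarrow> real^3^'v^'t \<Rightarrow> real \<Rightarrow> real^3 \<Rightarrow> real^3" where
  "Q3_fun S m t x = (\<Sum>j=0..Nt S. \<Sum>i\<in>UNIV. (phi S j t * psi S i x) *\<^sub>R (layer S m j $ i))"

definition V_h :: "('v::finite, 't::finite, 'b) ot_data \<Rightarrow> (real^'v^'t) set" where
  "V_h S = {v. (\<Sum>j=0..Nt S. wt S j * L2 S (S_fun S (layer S v j)) (\<lambda>x. 1)) = 0}"

section \<open>Recovered derivatives\<close>

definition G_tau :: "('v::finite, 't::finite, 'b) ot_data \<Rightarrow> real^'v^'t \<Rightarrow> real^'v^'t" where
  "G_tau S u = (\<chi> t. let j = tidx S t; n = Nt S; s = 1 / (2 * tau S) in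
     if j = 0 then s *\<^sub>R (- 3 *\<^sub>R layer S u 0 + 4 *\<^sub>R layer S u 1 - layer S u 2)
     else if j = n then s *\<^sub>R (3 *\<^sub>R layer S u n - 4 *\<^sub>R layer S u (n - 1) + layer S u (n - 2))
     else s *\<^sub>R (layer S u (j + 1) - layer S u (j - 1)))"

text \<open>Planar coordinates, centred at vertex \<open>i\<close>, of the projection of vertex \<open>k\<close>.\<close>
definition loc :: "('v::finite, 't::finite, 'b) ot_data \<Rightarrow> 'v \<Rightarrow> 'v \<Rightarrow> real^2" where
  "loc S i k = (\<chi> a. (vtx S k - vtx S i) \<bullet> frame S i a)"

definition quad_monomials :: "real^2 \<Rightarrow> real^6" where
  "quad_monomials \<xi> = vector [1, \<xi>$1, \<xi>$2, (\<xi>$1)\<^sup>2, \<xi>$1 * \<xi>$2, (\<xi>$2)\<^sup>2]"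

text \<open>Rows of vertices outside of the patch are zero, which does not change the rank.\<close>
definition design :: "('v::finite, 't::finite, 'b) ot_data \<Rightarrow> 'v \<Rightarrow> real^6^'v" where
  "design S i = (\<chi> k. if k \<in> patch S i then quad_monomials (loc S i k) else 0)"

definition r_fit :: "('v::finite, 't::finite, 'b) ot_data \<Rightarrow> 'v \<Rightarrow> real^2 \<Rightarrow> real^3" where
  "r_fit S i = (\<lambda>\<xi>. (ARG_MIN (\<lambda>C. \<Sum>k\<in>patch S i. (norm (C *v quad_monomials (loc S i k) - vtx S k))\<^sup>2) C. True)
                     *v quad_monomials \<xi>)"

definition q_fit :: "('v::finite, 't::finite, 'b) ot_data \<Rightarrow> 'v \<Rightarrow> real^'v \<Rightarrow> real^2 \<Rightarrow> real" where
  "q_fit S i u = (\<lambda>\<xi>. (ARG_MIN (\<lambda>c. \<Sum>k\<in>patch S i. (c \<bullet> quad_monomials (loc S i k) - u $ k)\<^sup>2) c. True)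
                       \<bullet> quad_monomials \<xi>)"

definition Jac :: "('v::finite, 't::finite, 'b) ot_data \<Rightarrow> 'v \<Rightarrow> real^2^3" where
  "Jac S i = jacobian (r_fit S i) (at 0)"

definition grad_q :: "('v::finite, 't::finite, 'b) ot_data \<Rightarrow> 'v \<Rightarrow> real^'v \<Rightarrow> real^2" where
  "grad_q S i u = (\<chi> a. frechet_derivative (q_fit S i u) (at 0) (axis a 1))"

definition G_h :: "('v::finite, 't::finite, 'b) ot_data \<Rightarrow> real^'v \<Rightarrow> real^3^'v" where
  "G_h S u = (\<chi> i. (Jac S i ** matrix_inv (transpose (Jac S i) ** Jac S i)) *v grad_q S i u)"

text \<open>\<open>B_comp S 1\<close>, \<open>B_comp S 2\<close>, \<open>B_comp S 3\<close> are the matrices \<open>B_x\<close>, \<open>B_y\<close>, \<open>B_z\<close>.\<close>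
definition B_comp :: "('v::finite, 't::finite, 'b) ot_data \<Rightarrow> 3 \<Rightarrow> real^'v^'v" where
  "B_comp S c = matrix (\<lambda>u. \<chi> i. G_h S u $ i $ c)"

definition G_h_div :: "('v::finite, 't::finite, 'b) ot_data \<Rightarrow> real^3^'v \<Rightarrow> real^'v" where
  "G_h_div S m = (\<Sum>c\<in>UNIV. B_comp S c *v (\<chi> i. m $ i $ c))"

definition recovery_ok :: "('v::finite, 't::finite, 'b) ot_data \<Rightarrow> bool" where
  "recovery_ok S \<longleftrightarrow> (\<forall>i.
     i \<in> patch S i \<and>
     (\<forall>k\<in>patch S i. (i, k) \<in> (adjacent S \<inter> patch S i \<times> patch S i)\<^sup>*) \<and>
     (\<forall>a b. frame S i a \<bullet> frame S i b = (if a = b then 1 else 0)) \<and>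
     rank (design S i) = 6 \<and>
     rank (Jac S i) = 2)"

section \<open>The space \<open>X_h\<close>, its coordinates and its metric\<close>

definition normals_ok :: "('v::finite, 't::finite, 'b) ot_data \<Rightarrow> bool" where
  "normals_ok S \<longleftrightarrow> (\<forall>i. norm (nrm S i) = 1 \<and> (\<forall>y\<in>range ((*v) (Jac S i)). nrm S i \<bullet> y = 0) \<and>
     inj (tb S i) \<and> independent (range (tb S i)) \<and>
     span (range (tb S i)) = {y. nrm S i \<bullet> y = 0})"

definition X_h :: "('v::finite, 't::finite, 'b) ot_data \<Rightarrow> ('v, 't) field set" where
  "X_h S = {(\<rho>, m). \<forall>t i. nrm S i \<bullet> (m $ t $ i) = 0}"

text \<open>Coordinates on \<open>X_h\<close>: \<open>Inl (t, i)\<close> is the density, \<open>Inr (t, i, a)\<close> the tangent component \<open>a\<close>.\<close>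
type_synonym ('v, 't) xidx = "('t \<times> 'v) + ('t \<times> 'v \<times> 2)"

definition of_coords ::
  "('v::finite, 't::finite, 'b) ot_data \<Rightarrow> real^(('v, 't) xidx) \<Rightarrow> ('v, 't) field" where
  "of_coords S x = ((\<chi> t i. x $ Inl (t, i)), (\<chi> t i. \<Sum>a\<in>UNIV. x $ Inr (t, i, a) *\<^sub>R tb S i a))"

definition coords ::
  "('v::finite, 't::finite, 'b) ot_data \<Rightarrow> ('v, 't) field \<Rightarrow> real^(('v, 't) xidx)" where
  "coords S z = (THE x. of_coords S x = z)"

definition X_inner ::
  "('v::finite, 't::finite, 'b) ot_data \<Rightarrow> ('v, 't) field \<Rightarrow> ('v, 't) field \<Rightarrow> real" where
  "X_inner S z z' = (\<Sum>j=0..Nt S. \<Sum>i\<in>UNIV. wt S j * mesh_integral S (\<lambda>T. psi S i) *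
     (layer S (fst z) j $ i * layer S (fst z') j $ i +
      (layer S (snd z) j $ i) \<bullet> (layer S (snd z') j $ i)))"

definition W_h :: "('v::finite, 't::finite, 'b) ot_data \<Rightarrow> real^(('v, 't) xidx)^(('v, 't) xidx)" where
  "W_h S = (\<chi> p q. X_inner S (of_coords S (axis p 1)) (of_coords S (axis q 1)))"

section \<open>Poisson problem and recovered update\<close>

definition a_h :: "('v::finite, 't::finite, 'b) ot_data \<Rightarrow> real^'v^'t \<Rightarrow> real^'v^'t \<Rightarrow> real" where
  "a_h S u v =
     (\<Sum>j=1..Nt S. tau S *
        L2 S (S_fun S ((1 / tau S) *\<^sub>R (layer S u j - layer S u (j - 1))))
             (S_fun S ((1 / tau S) *\<^sub>R (layer S v j - layer S v (j - 1))))) +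
     (\<Sum>j=0..Nt S. wt S j * mesh_integral S (\<lambda>T x.
        surf_grad S T (S_fun S (layer S u j)) x \<bullet> surf_grad S T (S_fun S (layer S v j)) x))"

definition endpoint_term :: "('v::finite, 't::finite, 'b) ot_data \<Rightarrow> ('v, 't) field \<Rightarrow> nat \<Rightarrow> real^'v" where
  "endpoint_term S z j =
     (if j = 0 then - (2 / tau S) *\<^sub>R (rho0 S - layer S (fst z) 0)
      else if j = Nt S then (2 / tau S) *\<^sub>R (rho1 S - layer S (fst z) (Nt S))
      else 0)"

definition ell_h ::
  "('v::finite, 't::finite, 'b) ot_data \<Rightarrow> ('v, 't) field \<Rightarrow> real^'v^'t \<Rightarrow> real" where
  "ell_h S z v = (\<Sum>j=0..Nt S. wt S j *
     L2 S (S_fun S (layer S (G_tau S (fst z)) j + G_h_div S (layer S (snd z) j) + endpoint_term S z j))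
          (S_fun S (layer S v j)))"

definition GG_h :: "('v::finite, 't::finite, 'b) ot_data \<Rightarrow> real^'v^'t \<Rightarrow> ('v, 't) field" where
  "GG_h S u = (G_tau S u, (\<chi> t. G_h S (u $ t)))"

definition Proj :: "('v::finite, 't::finite, 'b) ot_data \<Rightarrow> 'v \<Rightarrow> real^3^3" where
  "Proj S i = mat 1 - (\<chi> a b. nrm S i $ a * nrm S i $ b)"

definition R_map ::
  "('v::finite, 't::finite, 'b) ot_data \<Rightarrow> ('v, 't) field \<Rightarrow> ('v, 't) field" where
  "R_map S z = ((\<chi> t. if t = node S 0 then rho0 S else if t = node S (Nt S) then rho1 S else fst z $ t),
                (\<chi> t i. Proj S i *v (snd z $ t $ i)))"

definition phi_sol ::
  "('v::finite, 't::finite, 'b) ot_data \<Rightarrow> ('v, 't) field \<Rightarrow> real^'v^'t" where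
  "phi_sol S z = (THE \<phi>. \<phi> \<in> V_h S \<and> (\<forall>v\<in>V_h S. a_h S \<phi> v = ell_h S z v))"

definition P_upd ::
  "('v::finite, 't::finite, 'b) ot_data \<Rightarrow> ('v, 't) field \<Rightarrow> ('v, 't) field" where
  "P_upd S z = R_map S (z + GG_h S (phi_sol S z))"

section \<open>Matrix form\<close>

definition L_mat :: "('v::finite, 't::finite, 'b::finite) ot_data \<Rightarrow> real^'b^'b" where
  "L_mat S = (\<chi> k l. a_h S (vb S l) (vb S k))"

definition load ::
  "('v::finite, 't::finite, 'b::finite) ot_data \<Rightarrow> ('v, 't) field \<Rightarrow> real^'b" where
  "load S z = (\<chi> k. ell_h S z (vb S k))"

definition c_vec :: "('v::finite, 't::finite, 'b::finite) ot_data \<Rightarrow> real^'b" where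
  "c_vec S = load S 0"

definition D_mat :: "('v::finite, 't::finite, 'b::finite) ot_data \<Rightarrow> real^(('v, 't) xidx)^'b" where
  "D_mat S = matrix (\<lambda>x. load S (of_coords S x) - c_vec S)"

definition G_mat :: "('v::finite, 't::finite, 'b::finite) ot_data \<Rightarrow> real^'b^(('v, 't) xidx)" where
  "G_mat S = matrix (\<lambda>y. coords S (GG_h S (\<Sum>k\<in>UNIV. y $ k *\<^sub>R vb S k)))"

definition r_vec :: "('v::finite, 't::finite, 'b) ot_data \<Rightarrow> real^(('v, 't) xidx)" where
  "r_vec S = coords S (R_map S 0)"

definition R_mat ::
  "('v::finite, 't::finite, 'b) ot_data \<Rightarrow> real^(('v, 't) xidx)^(('v, 't) xidx)" where
  "R_mat S = matrix (\<lambda>x. coords S (R_map S (of_coords S x)) - r_vec S)"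

definition U_mat ::
  "('v::finite, 't::finite, 'b::finite) ot_data \<Rightarrow> real^(('v, 't) xidx)^(('v, 't) xidx)" where
  "U_mat S = mat 1 + G_mat S ** matrix_inv (L_mat S) ** D_mat S"

definition q_vec :: "('v::finite, 't::finite, 'b::finite) ot_data \<Rightarrow> real^(('v, 't) xidx)" where
  "q_vec S = (G_mat S ** matrix_inv (L_mat S)) *v c_vec S"

definition H_mat ::
  "('v::finite, 't::finite, 'b::finite) ot_data \<Rightarrow> real^(('v, 't) xidx)^(('v, 't) xidx)" where
  "H_mat S = R_mat S ** U_mat S"

definition k_vec :: "('v::finite, 't::finite, 'b::finite) ot_data \<Rightarrow> real^(('v, 't) xidx)" where
  "k_vec S = R_mat S *v q_vec S + r_vec S"

section \<open>Weak constraint system\<close>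

definition weak_lhs ::
  "('v::finite, 't::finite, 'b) ot_data \<Rightarrow> ('v, 't) field \<Rightarrow> real^'v^'t \<Rightarrow> real" where
  "weak_lhs S z v = (LINT t:{0..1}|lborel. mesh_integral S (\<lambda>T x.
     Q_fun S (fst z) t x * deriv (\<lambda>s. Q_fun S v s x) t +
     Q3_fun S (snd z) t x \<bullet> surf_grad S T (Q_fun S v t) x))"

definition weak_rhs :: "('v::finite, 't::finite, 'b) ot_data \<Rightarrow> real^'v^'t \<Rightarrow> real" where
  "weak_rhs S v = L2 S (S_fun S (rho1 S)) (S_fun S (layer S v (Nt S))) -
                  L2 S (S_fun S (rho0 S)) (S_fun S (layer S v 0))"

text \<open>
  Rows: \<open>Inl (t, i)\<close> is the weak equation tested with the tensor-product basis function whose only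
  nonzero nodal value is a 1 at \<open>(t, i)\<close>; \<open>Inr (Inl i)\<close> and \<open>Inr (Inr i)\<close> are the initial and
  final endpoint coefficient equations.
\<close>
type_synonym ('v, 't) cidx = "('t \<times> 'v) + ('v + 'v)"

definition A_mat ::
  "('v::finite, 't::finite, 'b) ot_data \<Rightarrow> real^(('v, 't) xidx)^(('v, 't) cidx)" where
  "A_mat S = matrix (\<lambda>x. let z = of_coords S x in \<chi> r. case r of
       Inl (t, i) \<Rightarrow> weak_lhs S z (axis t (axis i 1))
     | Inr (Inl i) \<Rightarrow> layer S (fst z) 0 $ i
     | Inr (Inr i) \<Rightarrow> layer S (fst z) (Nt S) $ i)"

definition b_vec :: "('v::finite, 't::finite, 'b) ot_data \<Rightarrow> real^(('v, 't) cidx)" where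
  "b_vec S = (\<chi> r. case r of
       Inl (t, i) \<Rightarrow> weak_rhs S (axis t (axis i 1))
     | Inr (Inl i) \<Rightarrow> rho0 S $ i
     | Inr (Inr i) \<Rightarrow> rho1 S $ i)"

section \<open>Standing assumptions and orthogonality\<close>

definition ot_discretisation :: "('v::finite, 't::finite, 'b::finite) ot_data \<Rightarrow> bool" where
  "ot_discretisation S \<longleftrightarrow>
     triangulated_surface S \<and> approximates_surface S \<and>
     Nt S \<ge> 2 \<and> bij_betw (node S) {0..Nt S} UNIV \<and>
     L2 S (S_fun S (rho0 S)) (\<lambda>x. 1) = 1 \<and> L2 S (S_fun S (rho1 S)) (\<lambda>x. 1) = 1 \<and>
     recovery_ok S \<and> normals_ok S \<and>
     inj (vb S) \<and> independent (range (vb S)) \<and> span (range (vb S)) = V_h S"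

text \<open>\<open>P\<close> is the orthogonal projection onto the affine subspace \<open>C\<close> in the metric with matrix \<open>W\<close>.
  In coordinates, the exact constraint set \<open>C_h\<close> is \<open>{x. A_mat S *v x = b_vec S}\<close>.\<close>
definition orthogonal_projection_onto ::
  "real^'n^'n \<Rightarrow> (real^'n \<Rightarrow> real^'n) \<Rightarrow> (real^'n) set \<Rightarrow> bool" where
  "orthogonal_projection_onto W P C \<longleftrightarrow>
     (\<forall>x. P x \<in> C) \<and> (\<forall>x. \<forall>y\<in>C. (x - P x) \<bullet> (W *v (y - P x)) = 0)"

end

theory Submission
  imports Defs
begin

text \<open>
  The nodal basis is given on each triangle by barycentric coordinates, so the integrals occurring in
  the forms are those of functions continuous on each triangle, and the forms are bilinear. If
  \<open>a_h(v, v) = 0\<close> then every time layer of \<open>v\<close> has zero gradient, hence is constant on the connected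
  mesh, consecutive layers agree, and the mean value condition forces \<open>v = 0\<close>; thus the Poisson
  matrix is invertible. The least squares fits depend linearly on the nodal values, so the recovered
  update really is \<open>x \<mapsto> H x + k\<close> in coordinates, and the identities and necessary
  conditions follow by evaluating at all \<open>x\<close>. For the last claim, \<open>A_h\<close> has more columns than
  rows, so it annihilates some \<open>v \<noteq> 0\<close>, and a suitable oblique rank-one projection onto the line
  through \<open>v\<close> satisfies all the algebraic conditions.
\<close>

section \<open>Nodal interpolation on a triangulated surface\<close>

abbreviation vertex_differences ::
  "('v::finite, 't::finite, 'b) ot_data \<Rightarrow> 'v \<times> 'v \<times> 'v \<Rightarrow> (real^3) set" where
  "vertex_differences S T \<equiv> {vtx S k - vtx S l |k l. k \<in> verts T \<and> l \<in> verts T}"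

text \<open>Fixing the gradient by nodal differences instead of a derivative makes it depend
  linearly on the nodal values; the span condition excludes a normal component.\<close>

definition tri_grad ::
  "('v::finite, 't::finite, 'b) ot_data \<Rightarrow> 'v \<times> 'v \<times> 'v \<Rightarrow> real^'v \<Rightarrow> real^3" where
  "tri_grad S T u = (THE g. g \<in> span (vertex_differences S T) \<and>
     (\<forall>k\<in>verts T. \<forall>l\<in>verts T. g \<bullet> (vtx S k - vtx S l) = u $ k - u $ l))"

definition tri_affine ::
  "('v::finite, 't::finite, 'b) ot_data \<Rightarrow> 'v \<times> 'v \<times> 'v \<Rightarrow> real^'v \<Rightarrow> real^3 \<Rightarrow> real" where
  "tri_affine S T u x = u $ fst T + tri_grad S T u \<bullet> (x - vtx S (fst T))"

text \<open>On shared edges and vertices the chosen triangle is ambiguous;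
  \<open>tri_affine_consistent\<close> shows that the value is not.\<close>

definition nodal_interpolant ::
  "('v::finite, 't::finite, 'b) ot_data \<Rightarrow> real^'v \<Rightarrow> real^3 \<Rightarrow> real" where
  "nodal_interpolant S u x =
     (if x \<in> mesh S then tri_affine S (SOME T. T \<in> tri S \<and> x \<in> cell S T) u x else 0)"

lemma fst_in_verts [simp]: "fst T \<in> verts T"
  by (cases T) (auto simp: verts_def)

lemma cross_norm_pos:
  assumes "triangulated_surface S" "(a, b, c) \<in> tri S"
  shows "norm (cross3 (vtx S b - vtx S a) (vtx S c - vtx S a)) > 0"
proof -
  have "\<not> collinear {vtx S b, vtx S a, vtx S c}"
    using assms by (fastforce simp: triangulated_surface_def verts_def insert_commute)
  then have "\<not> collinear {0, vtx S b - vtx S a, vtx S c - vtx S a}"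
    by (subst (asm) collinear_3) simp
  then show ?thesis by (simp add: cross_eq_0)
qed

text \<open>Orthogonality to \<open>D\<close> passes to its span, so \<open>g\<close> is orthogonal
  to itself.\<close>

lemma span_orthogonal_eq_0:
  fixes g :: "'a::euclidean_space"
  assumes "g \<in> span D" "\<And>y. y \<in> D \<Longrightarrow> g \<bullet> y = 0"
  shows "g = 0"
  using orthogonal_to_span[of g D g] assms by (simp add: orthogonal_def)

text \<open>The conditions form a linear system with the Gram matrix of \<open>d\<close> and
  \<open>e\<close>, whose determinant is the squared norm of the cross product.\<close>

lemma exists_gradient_in_span:
  fixes d e :: "real^3"
  assumes "cross3 d e \<noteq> 0"
  shows "\<exists>g\<in>span {d, e}. g \<bullet> d = s \<and> g \<bullet> e = t"
proof -
  define D where "D = (d \<bullet> d) * (e \<bullet> e) - (d \<bullet> e) * (d \<bullet> e)"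
  have "D = (norm (cross3 d e))\<^sup>2"
    using norm_cross_dot[of d e]
    by (simp add: D_def power_mult_distrib power2_norm_eq_inner) (simp add: power2_eq_square)
  with assms have D: "D \<noteq> 0" by simp
  \<comment> \<open>Cramer's rule for the Gram system.\<close>
  define g where "g = ((s * (e \<bullet> e) - t * (d \<bullet> e)) / D) *\<^sub>R d + ((t * (d \<bullet> d) - s * (d \<bullet> e)) / D) *\<^sub>R e"
  have "g \<bullet> d = (s * D) / D" "g \<bullet> e = (t * D) / D"
    unfolding g_def inner_add_left inner_scaleR_left times_divide_eq_left add_divide_distrib[symmetric]
    by (rule arg_cong[of _ _ "\<lambda>x. x / D"]; simp add: D_def inner_commute[of e d] algebra_simps)+
  moreover have "g \<in> span {d, e}"
    unfolding g_def by (intro span_add span_scale) (auto intro: span_base)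
  ultimately show ?thesis using D by auto
qed

text \<open>Two edges at one vertex determine all vertex differences, so the Gram system gives
  existence. Two solutions differ by a vector of the span that is orthogonal to its
  generators.\<close>

lemma tri_grad_ex1:
  assumes "triangulated_surface S" "T \<in> tri S"
  shows "\<exists>!g. g \<in> span (vertex_differences S T) \<and>
     (\<forall>k\<in>verts T. \<forall>l\<in>verts T. g \<bullet> (vtx S k - vtx S l) = u $ k - u $ l)"
proof -
  obtain a b c where T: "T = (a, b, c)" by (cases T)
  let ?d = "vtx S b - vtx S a" and ?e = "vtx S c - vtx S a"
  have "cross3 ?d ?e \<noteq> 0" using cross_norm_pos assms T by auto
  from exists_gradient_in_span[OF this] obtain g where
    g: "g \<in> span {?d, ?e}" "g \<bullet> ?d = u $ b - u $ a" "g \<bullet> ?e = u $ c - u $ a" by meson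
  have "span {?d, ?e} \<subseteq> span (vertex_differences S T)"
    by (rule span_mono) (auto simp: T verts_def)
  with g(1) have gs: "g \<in> span (vertex_differences S T)" by blast
  have gv: "\<forall>k\<in>verts T. \<forall>l\<in>verts T. g \<bullet> (vtx S k - vtx S l) = u $ k - u $ l"
    using g(2,3) by (auto simp: T verts_def inner_diff_right)
  show ?thesis
  proof (rule ex1I[of _ g])
    fix g' assume g': "g' \<in> span (vertex_differences S T) \<and>
      (\<forall>k\<in>verts T. \<forall>l\<in>verts T. g' \<bullet> (vtx S k - vtx S l) = u $ k - u $ l)"
    have "g' - g = 0"
    proof (rule span_orthogonal_eq_0[of _ "vertex_differences S T"])
      show "g' - g \<in> span (vertex_differences S T)" using g' gs by (blast intro: span_diff)
      fix y assume "y \<in> vertex_differences S T"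
      then show "(g' - g) \<bullet> y = 0" using g' gv by (auto simp: inner_diff_left)
    qed
    then show "g' = g" by simp
  qed (use gs gv in blast)
qed

lemma tri_grad_props:
  assumes "triangulated_surface S" "T \<in> tri S"
  shows tri_grad_in_span: "tri_grad S T u \<in> span (vertex_differences S T)"
    and tri_grad_inner: "k \<in> verts T \<Longrightarrow> l \<in> verts T \<Longrightarrow>
      tri_grad S T u \<bullet> (vtx S k - vtx S l) = u $ k - u $ l"
  using theI'[OF tri_grad_ex1[OF assms, of u]] unfolding tri_grad_def by blast+

lemma tri_grad_eqI:
  assumes "triangulated_surface S" "T \<in> tri S" "g \<in> span (vertex_differences S T)"
    "\<And>k l. k \<in> verts T \<Longrightarrow> l \<in> verts T \<Longrightarrow> g \<bullet> (vtx S k - vtx S l) = u $ k - u $ l"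
  shows "tri_grad S T u = g"
  unfolding tri_grad_def by (rule the1_equality[OF tri_grad_ex1]) (use assms in auto)

lemma linear_tri_grad:
  assumes "triangulated_surface S" "T \<in> tri S"
  shows "linear (tri_grad S T)"
  by (rule linearI; rule tri_grad_eqI[OF assms])
    (auto simp: tri_grad_props[OF assms] inner_add_left right_diff_distrib intro!: span_add span_scale)

lemma linear_tri_affine:
  assumes "triangulated_surface S" "T \<in> tri S"
  shows "linear (\<lambda>u. tri_affine S T u x)"
  using linear_tri_grad[OF assms]
  by (auto simp: linear_iff tri_affine_def inner_add_left algebra_simps)

lemma tri_affine_vtx:
  assumes "triangulated_surface S" "T \<in> tri S" "k \<in> verts T"
  shows "tri_affine S T u (vtx S k) = u $ k"
  using assms by (simp add: tri_affine_def tri_grad_inner)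

text \<open>The points where two affine functions agree solve one linear equation; they form a
  convex set containing \<open>Y\<close>.\<close>

lemma affine_eq_on_convex_hull:
  fixes g h :: "'a::real_inner"
  assumes "\<And>y. y \<in> Y \<Longrightarrow> c + g \<bullet> y = d + h \<bullet> y" "x \<in> convex hull Y"
  shows "c + g \<bullet> x = d + h \<bullet> x"
proof -
  have "convex hull Y \<subseteq> {y. (g - h) \<bullet> y = d - c}"
  proof (rule hull_minimal)
    show "Y \<subseteq> {y. (g - h) \<bullet> y = d - c}"
      using assms(1) by (force simp: inner_diff_left algebra_simps)
  qed (rule convex_hyperplane)
  then show ?thesis using assms(2) by (auto simp: inner_diff_left algebra_simps)
qed

lemma tri_affine_alt:
  "tri_affine S T u x = (u $ fst T - tri_grad S T u \<bullet> vtx S (fst T)) + tri_grad S T u \<bullet> x"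
  by (simp add: tri_affine_def inner_diff_right)

text \<open>Conformity of the mesh: two triangles meet in the hull of their common vertices, and at
  these vertices both affine functions take the nodal values.\<close>

lemma tri_affine_consistent:
  assumes S: "triangulated_surface S" and T: "T \<in> tri S" "T' \<in> tri S" "x \<in> cell S T" "x \<in> cell S T'"
  shows "tri_affine S T u x = tri_affine S T' u x"
proof -
  have "x \<in> convex hull (vtx S ` (verts T \<inter> verts T'))"
    using assms unfolding triangulated_surface_def by blast
  then show ?thesis unfolding tri_affine_alt
    by (rule affine_eq_on_convex_hull[rotated])
      (use tri_affine_vtx[OF S T(1)] tri_affine_vtx[OF S T(2)] in \<open>auto simp: tri_affine_alt\<close>)
qed

lemma nodal_interpolant_cell:
  assumes "triangulated_surface S" "T \<in> tri S" "x \<in> cell S T"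
  shows "nodal_interpolant S u x = tri_affine S T u x"
proof -
  let ?T = "SOME T. T \<in> tri S \<and> x \<in> cell S T"
  have "?T \<in> tri S \<and> x \<in> cell S ?T" by (rule someI[of _ T]) (use assms in simp)
  moreover have "x \<in> mesh S" using assms by (auto simp: mesh_def)
  ultimately show ?thesis using assms tri_affine_consistent[of S ?T T x u]
    by (simp add: nodal_interpolant_def)
qed

lemma linear_nodal_interpolant:
  assumes "triangulated_surface S"
  shows "linear (\<lambda>u. nodal_interpolant S u x)"
proof (cases "x \<in> mesh S")
  case True
  then obtain T where T: "T \<in> tri S" "x \<in> cell S T" by (auto simp: mesh_def)
  show ?thesis unfolding nodal_interpolant_cell[OF assms T] by (rule linear_tri_affine[OF assms T(1)])
qed (simp add: nodal_interpolant_def linear_iff)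

lemma vtx_in_cell: "k \<in> verts T \<Longrightarrow> vtx S k \<in> cell S T"
  by (auto simp: cell_def intro: hull_inc)

lemma nodal_interpolant_vtx:
  assumes "triangulated_surface S"
  shows "nodal_interpolant S u (vtx S k) = u $ k"
proof -
  obtain T where "T \<in> tri S" "k \<in> verts T"
    using assms unfolding triangulated_surface_def by blast
  then show ?thesis using assms by (simp add: nodal_interpolant_cell vtx_in_cell tri_affine_vtx)
qed

lemma finite_tri [simp]: "finite (tri (S :: ('v::finite, 't::finite, 'b) ot_data))"
  by (rule finite_subset[OF subset_UNIV finite])

lemma compact_cell: "compact (cell S T)"
  by (cases T) (simp add: cell_def verts_def finite_imp_compact compact_convex_hull)

lemma continuous_on_tri_affine [continuous_intros]: "continuous_on X (tri_affine S T u)"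
  unfolding tri_affine_def by (intro continuous_intros)

text \<open>Continuity holds by gluing: the mesh is a finite union of closed cells, on each of which
  the interpolant is affine.\<close>

lemma nodal_interpolant_in_S_h:
  assumes "triangulated_surface S"
  shows "nodal_interpolant S u \<in> S_h S"
proof -
  have "continuous_on (mesh S) (nodal_interpolant S u)"
    unfolding mesh_def
  proof (rule continuous_on_closed_Union)
    fix T assume T: "T \<in> tri S"
    show "closed (cell S T)" by (rule compact_imp_closed[OF compact_cell])
    show "continuous_on (cell S T) (nodal_interpolant S u)"
      by (rule continuous_on_eq[OF continuous_on_tri_affine])
        (simp add: nodal_interpolant_cell[OF assms T])
  qed simp
  moreover have "\<exists>c g. \<forall>x\<in>cell S T. nodal_interpolant S u x = c + g \<bullet> x" if "T \<in> tri S" for T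
    using nodal_interpolant_cell[OF assms that, of _ u] tri_affine_alt[of S T u] by metis
  ultimately show ?thesis by (auto simp: S_h_def nodal_interpolant_def)
qed

text \<open>A function affine on a triangle is fixed there by its vertex values. This is the
  uniqueness needed to resolve the description in \<open>psi\<close>.\<close>

lemma S_h_eq_nodal_interpolant:
  assumes S: "triangulated_surface S" and f: "f \<in> S_h S"
  shows "f = nodal_interpolant S (\<chi> k. f (vtx S k))"
proof
  fix x
  let ?u = "\<chi> k. f (vtx S k)"
  show "f x = nodal_interpolant S ?u x"
  proof (cases "x \<in> mesh S")
    case True
    then obtain T where T: "T \<in> tri S" "x \<in> cell S T" by (auto simp: mesh_def)
    from f T(1) obtain c g where cg: "\<And>x. x \<in> cell S T \<Longrightarrow> f x = c + g \<bullet> x"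
      unfolding S_h_def by blast
    have "c + g \<bullet> x = (?u $ fst T - tri_grad S T ?u \<bullet> vtx S (fst T)) + tri_grad S T ?u \<bullet> x"
    proof (rule affine_eq_on_convex_hull)
      fix y assume "y \<in> vtx S ` verts T"
      then obtain k where k: "k \<in> verts T" "y = vtx S k" by blast
      have "c + g \<bullet> y = tri_affine S T ?u y"
        using tri_affine_vtx[OF S T(1) k(1), of ?u] cg[OF vtx_in_cell[OF k(1)]] k by simp
      then show "c + g \<bullet> y = (?u $ fst T - tri_grad S T ?u \<bullet> vtx S (fst T)) + tri_grad S T ?u \<bullet> y"
        unfolding tri_affine_alt .
    qed (use T(2) in \<open>simp add: cell_def\<close>)
    then show ?thesis using cg[OF T(2)] nodal_interpolant_cell[OF S T, of ?u]
      unfolding tri_affine_alt by simp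
  qed (use f in \<open>simp add: S_h_def nodal_interpolant_def\<close>)
qed

lemma psi_eq_nodal_interpolant:
  assumes "triangulated_surface S"
  shows "psi S i = nodal_interpolant S (axis i 1)"
  unfolding psi_def
proof (rule the_equality)
  show "nodal_interpolant S (axis i 1) \<in> S_h S \<and>
      (\<forall>k. nodal_interpolant S (axis i 1) (vtx S k) = (if k = i then 1 else 0))"
    using assms by (simp add: nodal_interpolant_in_S_h nodal_interpolant_vtx axis_def)
  fix f assume f: "f \<in> S_h S \<and> (\<forall>k. f (vtx S k) = (if k = i then 1 else 0))"
  then have "(\<chi> k. f (vtx S k)) = axis i 1" by (simp add: vec_eq_iff axis_def)
  with S_h_eq_nodal_interpolant[OF assms, of f] f show "f = nodal_interpolant S (axis i 1)" by simp
qed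

lemma linear_eq_sum_axis:
  fixes f :: "real^'n \<Rightarrow> 'a::real_vector"
  assumes "linear f"
  shows "f u = (\<Sum>i\<in>UNIV. u $ i *\<^sub>R f (axis i 1))"
proof -
  have "f u = f (\<Sum>i\<in>UNIV. u $ i *\<^sub>R axis i 1)"
    using basis_expansion[of u] by (simp add: scalar_mult_eq_scaleR)
  then show ?thesis using assms by (simp add: linear_sum linear_scale)
qed

lemma S_fun_eq_nodal_interpolant:
  assumes "triangulated_surface S"
  shows "S_fun S u = nodal_interpolant S u"
proof
  fix x
  show "S_fun S u x = nodal_interpolant S u x"
    using linear_eq_sum_axis[OF linear_nodal_interpolant[OF assms], of u x]
    by (simp add: S_fun_def psi_eq_nodal_interpolant[OF assms])
qed

lemma psi_eq_S_fun:
  assumes "triangulated_surface S"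
  shows "psi S i = S_fun S (axis i 1)"
  using assms by (simp add: psi_eq_nodal_interpolant S_fun_eq_nodal_interpolant)

lemma linear_S_fun: "linear (\<lambda>u. S_fun S u x)"
  by (simp add: linear_iff S_fun_def sum.distrib sum_distrib_left algebra_simps)

lemma S_fun_cell:
  assumes "triangulated_surface S" "T \<in> tri S" "x \<in> cell S T"
  shows "S_fun S u x = tri_affine S T u x"
  using assms by (simp add: S_fun_eq_nodal_interpolant nodal_interpolant_cell)

lemma continuous_on_S_fun:
  assumes "triangulated_surface S"
  shows "continuous_on (mesh S) (S_fun S u)"
  using nodal_interpolant_in_S_h[OF assms, of u] assms
  by (simp add: S_fun_eq_nodal_interpolant S_h_def)

lemma cell_subset_mesh: "T \<in> tri S \<Longrightarrow> cell S T \<subseteq> mesh S"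
  by (auto simp: mesh_def)

section \<open>Surface gradients of finite element functions\<close>

lemma convex_gradient_unique:
  fixes f :: "'a::real_inner \<Rightarrow> real"
  assumes "convex C" "x \<in> C" "y \<in> C"
    and "(f has_derivative (\<lambda>h. g \<bullet> h)) (at x within C)" "(f has_derivative (\<lambda>h. g' \<bullet> h)) (at x within C)"
  shows "g \<bullet> (y - x) = g' \<bullet> (y - x)"
proof -
  let ?p = "\<lambda>t::real. x + t *\<^sub>R (y - x)"
  have sub: "?p ` {0..1} \<subseteq> C"
  proof -
    have "(1 - t) *\<^sub>R x + t *\<^sub>R y \<in> C" if "0 \<le> t" "t \<le> 1" for t
      using assms(1-3) that by (simp add: convexD)
    then show ?thesis by (force simp: algebra_simps)
  qed
  have p: "(?p has_derivative (\<lambda>t. t *\<^sub>R (y - x))) (at 0 within {0..1})"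
    by (auto intro!: derivative_eq_intros)
  have D: "((\<lambda>t. f (?p t)) has_vector_derivative (d \<bullet> (y - x))) (at 0 within {0..1})"
    if "(f has_derivative (\<lambda>h. d \<bullet> h)) (at x within C)" for d
  proof -
    have "(f has_derivative (\<lambda>h. d \<bullet> h)) (at (?p 0) within ?p ` {0..1})"
      using that sub by (auto intro: has_derivative_subset)
    from has_derivative_in_compose[OF p this] show ?thesis
      by (simp add: has_vector_derivative_def mult.commute)
  qed
  show ?thesis
    by (rule vector_derivative_unique_within_closed_interval[of 0 1 0])
      (use D[OF assms(4)] D[OF assms(5)] in auto)
qed

lemma surf_grad_S_fun:
  assumes S: "triangulated_surface S" and T: "T \<in> tri S" and x: "x \<in> cell S T"
  shows "surf_grad S T (S_fun S u) x = tri_grad S T u"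
proof -
  have "(tri_affine S T u has_derivative (\<lambda>h. tri_grad S T u \<bullet> h)) (at x within cell S T)"
    unfolding tri_affine_def by (auto intro!: derivative_eq_intros)
  then have D: "(S_fun S u has_derivative (\<lambda>h. tri_grad S T u \<bullet> h)) (at x within cell S T)"
    by (rule has_derivative_transform[rotated 2]) (use S_fun_cell[OF S T] x in auto)
  show ?thesis unfolding surf_grad_def
  proof (rule the_equality)
    fix g assume g: "g \<in> span (vertex_differences S T) \<and>
      (S_fun S u has_derivative (\<bullet>) g) (at x within cell S T)"
    have conv: "convex (cell S T)" by (simp add: cell_def)
    have eq: "g \<bullet> (y - x) = tri_grad S T u \<bullet> (y - x)" if "y \<in> cell S T" for y
      by (rule convex_gradient_unique[OF conv x that _ D]) (use g in auto)
    have "g - tri_grad S T u = 0"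
    proof (rule span_orthogonal_eq_0[of _ "vertex_differences S T"])
      show "g - tri_grad S T u \<in> span (vertex_differences S T)"
        using g tri_grad_in_span[OF S T] by (blast intro: span_diff)
      fix d assume "d \<in> vertex_differences S T"
      then obtain k l where d: "d = vtx S k - vtx S l" "k \<in> verts T" "l \<in> verts T" by blast
      \<comment> \<open>The derivative within the cell is compared only in directions from
        \<open>x\<close> to points of the cell; an edge vector is a difference of two such
        directions.\<close>
      have "d = (vtx S k - x) - (vtx S l - x)" by (simp add: d)
      then show "(g - tri_grad S T u) \<bullet> d = 0"
        using eq[OF vtx_in_cell[OF d(2)]] eq[OF vtx_in_cell[OF d(3)]]
        by (simp add: inner_diff_left inner_diff_right)
    qed
    then show "g = tri_grad S T u" by simp
  qed (use D tri_grad_in_span[OF S T] in auto)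
qed

section \<open>Surface integrals of finite element functions\<close>

abbreviation unit_simplex :: "(real \<times> real) set" where
  "unit_simplex \<equiv> {(x, y). 0 \<le> x \<and> 0 \<le> y \<and> x + y \<le> 1}"

lemma compact_unit_simplex: "compact unit_simplex"
proof -
  have "closed {p :: real \<times> real. 0 \<le> fst p \<and> 0 \<le> snd p \<and> fst p + snd p \<le> 1}"
    by (intro closed_Collect_conj closed_Collect_le continuous_intros)
  moreover have "{p :: real \<times> real. 0 \<le> fst p \<and> 0 \<le> snd p \<and> fst p + snd p \<le> 1} = unit_simplex"
    by auto
  ultimately have "closed unit_simplex" by simp
  moreover have "unit_simplex \<subseteq> cbox (0, 0) (1, 1)" by (auto simp: mem_box Basis_prod_def)
  then have "bounded unit_simplex" using bounded_subset[OF bounded_cbox] by blast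
  ultimately show ?thesis by (simp add: compact_eq_bounded_closed)
qed

section \<open>Integration over a single triangle\<close>

definition param ::
  "('v::finite, 't::finite, 'b) ot_data \<Rightarrow> 'v \<times> 'v \<times> 'v \<Rightarrow> real \<times> real \<Rightarrow> real^3" where
  "param S T p = (case T of (a, b, c) \<Rightarrow>
     vtx S a + fst p *\<^sub>R (vtx S b - vtx S a) + snd p *\<^sub>R (vtx S c - vtx S a))"

definition tri_jac :: "('v::finite, 't::finite, 'b) ot_data \<Rightarrow> 'v \<times> 'v \<times> 'v \<Rightarrow> real" where
  "tri_jac S T = (case T of (a, b, c) \<Rightarrow> norm (cross3 (vtx S b - vtx S a) (vtx S c - vtx S a)))"

lemma cell_integral_param:
  "cell_integral S T f = tri_jac S T * (LINT p:unit_simplex|lborel. f (param S T p))"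
  by (simp add: cell_integral_def param_def tri_jac_def split: prod.split)

lemma tri_jac_pos:
  assumes "triangulated_surface S" "T \<in> tri S"
  shows "tri_jac S T > 0"
  using assms cross_norm_pos[of S] by (cases T) (auto simp: tri_jac_def)

lemma param_in_cell: "p \<in> unit_simplex \<Longrightarrow> param S T p \<in> cell S T"
  by (cases T, cases p) (auto simp: param_def cell_def verts_def convex_hull_3_alt)

lemma continuous_on_param: "continuous_on X (param S T)"
  by (cases T) (auto simp: param_def intro!: continuous_intros)

lemma set_integrable_param:
  fixes f :: "real^3 \<Rightarrow> real"
  assumes "continuous_on (cell S T) f"
  shows "set_integrable lborel unit_simplex (\<lambda>p. f (param S T p))"
proof -
  have "continuous_on unit_simplex (\<lambda>p. f (param S T p))"
    by (rule continuous_on_compose2[OF assms continuous_on_param]) (use param_in_cell in blast)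
  then show ?thesis
    unfolding set_integrable_def by (rule borel_integrable_compact[OF compact_unit_simplex])
qed

lemma cell_integral_cong:
  assumes "\<And>x. x \<in> cell S T \<Longrightarrow> f x = g x"
  shows "cell_integral S T f = cell_integral S T g"
proof -
  have "(LINT p:unit_simplex|lborel. f (param S T p)) = (LINT p:unit_simplex|lborel. g (param S T p))"
  proof (rule set_lebesgue_integral_cong)
    show "unit_simplex \<in> sets lborel"
      using compact_imp_closed[OF compact_unit_simplex] by simp
  qed (use assms[OF param_in_cell] in blast)
  then show ?thesis by (simp add: cell_integral_param)
qed

lemma cell_integral_add:
  assumes "continuous_on (cell S T) f" "continuous_on (cell S T) g"
  shows "cell_integral S T (\<lambda>x. f x + g x) = cell_integral S T f + cell_integral S T g"
  using set_integral_add(2)[OF set_integrable_param[OF assms(1)] set_integrable_param[OF assms(2)]]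
  by (simp add: cell_integral_param distrib_left)

lemma cell_integral_cmult: "cell_integral S T (\<lambda>x. r * f x) = r * cell_integral S T f"
  by (simp add: cell_integral_param)

lemma cell_integral_nonneg:
  assumes "\<And>x. x \<in> cell S T \<Longrightarrow> 0 \<le> f x"
  shows "0 \<le> cell_integral S T f"
proof -
  have "0 \<le> (LINT p:unit_simplex|lborel. f (param S T p))"
    unfolding set_lebesgue_integral_def
  proof (rule integral_nonneg_AE, rule AE_I2)
    show "0 \<le> indicat_real unit_simplex p *\<^sub>R f (param S T p)" for p
      using assms[OF param_in_cell, of p] by (simp add: indicator_def)
  qed
  then show ?thesis by (auto simp: cell_integral_param tri_jac_def split: prod.split)
qed

text \<open>Nonnegativity bounds the integral below by its part over a fixed square in the simplex,
  where the integrand is at least \<open>e\<close>.\<close>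

lemma cell_integral_pos:
  assumes S: "triangulated_surface S" "T \<in> tri S" and f: "continuous_on (cell S T) f"
    and nn: "\<And>x. x \<in> cell S T \<Longrightarrow> 0 \<le> f x"
    and pos: "\<And>p. p \<in> cbox (1/6, 1/6) (1/3, 1/3) \<Longrightarrow> e \<le> f (param S T p)" and e: "e > 0"
  shows "0 < cell_integral S T f"
proof -
  \<comment> \<open>On this square all three barycentric coordinates are at least 1/6, the lower
    bound later used for nodal basis functions.\<close>
  let ?B = "cbox (1/6, 1/6) (1/3, 1/3) :: (real \<times> real) set"
  have m: "measure lborel ?B = 1/36"
    by (subst content_Pair) simp
  have sub: "?B \<subseteq> unit_simplex" by (auto simp: mem_box Basis_prod_def)
  have "integrable lborel (indicator ?B :: _ \<Rightarrow> real)"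
    by (auto intro!: integrable_real_indicator emeasure_lborel_cbox_finite)
  then have iB: "integrable lborel (\<lambda>p. e * indicator ?B p)" by (rule integrable_mult_right)
  have "(LINT p|lborel. e * indicator ?B p) \<le> (LINT p:unit_simplex|lborel. f (param S T p))"
    unfolding set_lebesgue_integral_def
  proof (rule integral_mono[OF iB])
    show "integrable lborel (\<lambda>p. indicator unit_simplex p *\<^sub>R f (param S T p))"
      using set_integrable_param[OF f] unfolding set_integrable_def .
    fix p show "e * indicator ?B p \<le> indicator unit_simplex p *\<^sub>R f (param S T p)"
    proof (cases "p \<in> unit_simplex")
      case True
      show ?thesis
      proof (cases "p \<in> ?B")
        case True
        with sub have "p \<in> unit_simplex" by blast
        with True pos[OF True] show ?thesis by (simp add: indicator_def)
      next
        case False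
        with \<open>p \<in> unit_simplex\<close> nn[OF param_in_cell[OF True]] show ?thesis by (simp add: indicator_def)
      qed
    next
      case False
      with sub have "p \<notin> ?B" by blast
      with False show ?thesis by (simp add: indicator_def)
    qed
  qed
  moreover have "(LINT p|lborel. e * indicator ?B p) = e * (1/36)" using m by simp
  ultimately have "0 < (LINT p:unit_simplex|lborel. f (param S T p))" using e by linarith
  then show ?thesis by (simp add: cell_integral_param tri_jac_pos[OF S])
qed

section \<open>Integration over the mesh\<close>

lemma mesh_integral_cong:
  assumes "\<And>T x. T \<in> tri S \<Longrightarrow> x \<in> cell S T \<Longrightarrow> F T x = G T x"
  shows "mesh_integral S F = mesh_integral S G"
  unfolding mesh_integral_def by (intro sum.cong refl cell_integral_cong assms)

lemma mesh_integral_add: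
  assumes "\<And>T. T \<in> tri S \<Longrightarrow> continuous_on (cell S T) (F T)"
    "\<And>T. T \<in> tri S \<Longrightarrow> continuous_on (cell S T) (G T)"
  shows "mesh_integral S (\<lambda>T x. F T x + G T x) = mesh_integral S F + mesh_integral S G"
  by (simp add: mesh_integral_def cell_integral_add assms sum.distrib)

lemma mesh_integral_cmult: "mesh_integral S (\<lambda>T x. r * F T x) = r * mesh_integral S F"
  by (simp add: mesh_integral_def cell_integral_cmult sum_distrib_left)

lemma mesh_integral_nonneg:
  assumes "\<And>T x. T \<in> tri S \<Longrightarrow> x \<in> cell S T \<Longrightarrow> 0 \<le> F T x"
  shows "0 \<le> mesh_integral S F"
  unfolding mesh_integral_def by (intro sum_nonneg cell_integral_nonneg assms)

lemma mesh_integral_pos: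
  assumes "\<And>T x. T \<in> tri S \<Longrightarrow> x \<in> cell S T \<Longrightarrow> 0 \<le> F T x"
    and "T \<in> tri S" "0 < cell_integral S T (F T)"
  shows "0 < mesh_integral S F"
  unfolding mesh_integral_def
  by (rule sum_pos2[OF finite_tri assms(2), where f = "\<lambda>T. cell_integral S T (F T)"])
    (intro cell_integral_nonneg assms)+

lemma continuous_on_cell_S_fun:
  assumes "triangulated_surface S" "T \<in> tri S"
  shows "continuous_on (cell S T) (S_fun S u)"
  by (rule continuous_on_subset[OF continuous_on_S_fun[OF assms(1)] cell_subset_mesh[OF assms(2)]])

lemma linear_L2_S_fun:
  assumes "triangulated_surface S" "continuous_on (mesh S) f"
  shows "linear (\<lambda>u. L2 S (S_fun S u) f)"
proof (rule linearI)
  have f: "continuous_on (cell S T) f" if "T \<in> tri S" for T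
    by (rule continuous_on_subset[OF assms(2) cell_subset_mesh[OF that]])
  have "mesh_integral S (\<lambda>T x. S_fun S u x * f x + S_fun S v x * f x)
      = mesh_integral S (\<lambda>T x. S_fun S u x * f x) + mesh_integral S (\<lambda>T x. S_fun S v x * f x)" for u v
    by (rule mesh_integral_add; intro continuous_intros f continuous_on_cell_S_fun[OF assms(1)])
  then show "L2 S (S_fun S (u + v)) f = L2 S (S_fun S u) f + L2 S (S_fun S v) f" for u v
    by (simp add: L2_def linear_add[OF linear_S_fun] distrib_right)
  show "L2 S (S_fun S (r *\<^sub>R u)) f = r *\<^sub>R L2 S (S_fun S u) f" for r u
    by (simp add: L2_def linear_scale[OF linear_S_fun] mult.assoc mesh_integral_cmult)
qed

section \<open>Mass and stiffness forms\<close>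

lemma L2_commute: "L2 S f g = L2 S g f"
  by (simp add: L2_def mult.commute)

lemma L2_self_nonneg: "0 \<le> L2 S f f"
  unfolding L2_def by (rule mesh_integral_nonneg) simp

text \<open>The gradient part of \<open>a_h\<close> on one time layer, with an integrand that is
  constant on each triangle.\<close>

definition stiffness ::
  "('v::finite, 't::finite, 'b) ot_data \<Rightarrow> real^'v \<Rightarrow> real^'v \<Rightarrow> real" where
  "stiffness S u v = mesh_integral S (\<lambda>T x. tri_grad S T u \<bullet> tri_grad S T v)"

lemma stiffness_commute: "stiffness S u v = stiffness S v u"
  by (simp add: stiffness_def inner_commute)

lemma linear_stiffness:
  assumes "triangulated_surface S"
  shows "linear (\<lambda>u. stiffness S u v)"
proof (rule linearI)
  show "stiffness S (u + u') v = stiffness S u v + stiffness S u' v" for u u'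
    unfolding stiffness_def
    by (subst mesh_integral_add[symmetric])
      (auto intro!: continuous_intros mesh_integral_cong
        simp: linear_add[OF linear_tri_grad[OF assms]] inner_add_left)
  show "stiffness S (r *\<^sub>R u) v = r *\<^sub>R stiffness S u v" for r u
    unfolding stiffness_def real_scaleR_def mesh_integral_cmult[symmetric]
    by (rule mesh_integral_cong) (simp add: linear_scale[OF linear_tri_grad[OF assms]])
qed

lemma stiffness_surf_grad:
  assumes "triangulated_surface S"
  shows "mesh_integral S (\<lambda>T x. surf_grad S T (S_fun S u) x \<bullet> surf_grad S T (S_fun S v) x)
    = stiffness S u v"
  unfolding stiffness_def by (rule mesh_integral_cong) (simp add: surf_grad_S_fun[OF assms])

lemma stiffness_nonneg: "0 \<le> stiffness S u u"
  unfolding stiffness_def by (rule mesh_integral_nonneg) simp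

lemma tri_nonempty:
  assumes "triangulated_surface S"
  obtains T where "T \<in> tri S" "i \<in> verts T"
  using assms unfolding triangulated_surface_def by blast

lemma constant_if_stiffness_eq_0:
  assumes S: "triangulated_surface S" and "stiffness S u u = 0"
  shows "u $ i = u $ k"
proof -
  have g: "tri_grad S T u = 0" if T: "T \<in> tri S" for T
  proof (rule ccontr)
    assume "tri_grad S T u \<noteq> 0"
    then have "0 < cell_integral S T (\<lambda>x. tri_grad S T u \<bullet> tri_grad S T u)"
      by (intro cell_integral_pos[OF S T, where e = "tri_grad S T u \<bullet> tri_grad S T u"]) auto
    then have "0 < stiffness S u u"
      unfolding stiffness_def by (intro mesh_integral_pos[OF _ T]) auto
    with assms(2) show False by simp
  qed
  \<comment> \<open>With zero gradients each triangle contributes a single value, so the interpolant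
    has finite range; being continuous on a connected set, it is constant.\<close>
  have "S_fun S u ` mesh S \<subseteq> (\<lambda>T. u $ fst T) ` tri S"
  proof
    fix y assume "y \<in> S_fun S u ` mesh S"
    then obtain T x where "T \<in> tri S" "x \<in> cell S T" "y = S_fun S u x" by (auto simp: mesh_def)
    then show "y \<in> (\<lambda>T. u $ fst T) ` tri S"
      by (auto simp: S_fun_cell[OF S] tri_affine_def g)
  qed
  then have "finite (S_fun S u ` mesh S)" by (rule finite_subset) simp
  moreover have "connected (mesh S)" using S by (simp add: triangulated_surface_def)
  ultimately have "S_fun S u constant_on mesh S"
    using continuous_finite_range_constant continuous_on_S_fun[OF S] by blast
  then obtain c where c: "\<And>x. x \<in> mesh S \<Longrightarrow> S_fun S u x = c" by (auto simp: constant_on_def)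
  have "u $ j = c" for j
  proof -
    obtain T where T: "T \<in> tri S" "j \<in> verts T" by (rule tri_nonempty[OF S])
    with c[of "vtx S j"] show ?thesis
      using cell_subset_mesh[OF T(1)] vtx_in_cell[OF T(2)]
      by (auto simp: S_fun_eq_nodal_interpolant[OF S] nodal_interpolant_vtx[OF S])
  qed
  then show ?thesis by simp
qed

lemma mesh_area_pos:
  assumes S: "triangulated_surface S"
  shows "0 < mesh_integral S (\<lambda>T x. 1)"
proof -
  obtain T where T: "T \<in> tri S" by (rule tri_nonempty[OF S])
  show ?thesis
    by (rule mesh_integral_pos[OF _ T]) (auto intro!: cell_integral_pos[OF S T, where e = 1])
qed

lemma S_fun_constant:
  assumes S: "triangulated_surface S" and u: "\<And>i. u $ i = c" and x: "x \<in> mesh S"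
  shows "S_fun S u x = c"
proof -
  from x obtain T where T: "T \<in> tri S" "x \<in> cell S T" by (auto simp: mesh_def)
  have "tri_grad S T u = 0" by (rule tri_grad_eqI[OF S T(1)]) (simp_all add: u span_zero)
  then show ?thesis by (simp add: S_fun_cell[OF S T] tri_affine_def u)
qed

lemma L2_S_fun_constant:
  assumes S: "triangulated_surface S" and u: "\<And>i. u $ i = c" and v: "\<And>i. v $ i = d"
  shows "L2 S (S_fun S u) (S_fun S v) = c * d * mesh_integral S (\<lambda>T x. 1)"
    and "L2 S (S_fun S u) (\<lambda>x. 1) = c * mesh_integral S (\<lambda>T x. 1)"
proof -
  have *: "S_fun S u x = c" "S_fun S v x = d" if "T \<in> tri S" "x \<in> cell S T" for T x
    using S_fun_constant[OF S u] S_fun_constant[OF S v] cell_subset_mesh that by blast+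
  show "L2 S (S_fun S u) (S_fun S v) = c * d * mesh_integral S (\<lambda>T x. 1)"
    unfolding L2_def mesh_integral_cmult[symmetric] by (rule mesh_integral_cong) (simp add: *)
  show "L2 S (S_fun S u) (\<lambda>x. 1) = c * mesh_integral S (\<lambda>T x. 1)"
    unfolding L2_def mesh_integral_cmult[symmetric] by (rule mesh_integral_cong) (simp add: *)
qed

text \<open>The coefficients are the barycentric coordinates of the point, from which sign and size
  of nodal basis functions are read off.\<close>

lemma tri_affine_param:
  assumes "triangulated_surface S" "(a, b, c) \<in> tri S"
  shows "tri_affine S (a, b, c) u (param S (a, b, c) p)
    = (1 - fst p - snd p) * u $ a + fst p * u $ b + snd p * u $ c"
proof -
  have "tri_grad S (a, b, c) u \<bullet> (vtx S b - vtx S a) = u $ b - u $ a"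
    "tri_grad S (a, b, c) u \<bullet> (vtx S c - vtx S a) = u $ c - u $ a"
    by (intro tri_grad_inner[OF assms]; simp add: verts_def)+
  then show ?thesis
    by (simp add: tri_affine_def param_def inner_add_right) (simp add: algebra_simps)
qed

text \<open>These integrals are the spatial weights of the metric. Barycentric coordinates make the
  integrand nonnegative, and a triangle at vertex \<open>i\<close> contributes a positive
  amount.\<close>

lemma psi_integral_pos:
  assumes S: "triangulated_surface S"
  shows "0 < mesh_integral S (\<lambda>T. psi S i)"
proof -
  have aff: "psi S i x = tri_affine S T (axis i 1) x" if "T \<in> tri S" "x \<in> cell S T" for T x
    using that by (simp add: psi_eq_S_fun[OF S] S_fun_cell[OF S])
  have nn: "0 \<le> psi S i x" if T: "T \<in> tri S" "x \<in> cell S T" for T x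
  proof -
    obtain a b c where abc: "T = (a, b, c)" by (cases T)
    obtain p where p: "p \<in> unit_simplex" "x = param S T p"
      using T(2) by (auto simp: abc cell_def verts_def convex_hull_3_alt param_def)
    have "0 \<le> (1 - fst p - snd p) * axis i 1 $ a + fst p * axis i 1 $ b + snd p * axis i (1::real) $ c"
      using p(1) by (intro add_nonneg_nonneg mult_nonneg_nonneg) (auto simp: axis_def)
    then show ?thesis
      unfolding aff[OF T] using T(1) S by (simp add: p(2) abc tri_affine_param)
  qed
  obtain T where T: "T \<in> tri S" "i \<in> verts T" by (rule tri_nonempty[OF S])
  obtain a b c where abc: "T = (a, b, c)" by (cases T)
  have "0 < cell_integral S T (psi S i)"
  proof (rule cell_integral_pos[OF S T(1), where e = "1/6"])
    show "continuous_on (cell S T) (psi S i)"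
      unfolding psi_eq_S_fun[OF S] by (rule continuous_on_cell_S_fun[OF S T(1)])
    fix p :: "real \<times> real" assume "p \<in> cbox (1/6, 1/6) (1/3, 1/3)"
    then have p: "1/6 \<le> fst p" "1/6 \<le> snd p" "fst p \<le> 1/3" "snd p \<le> 1/3"
      by (cases p; auto simp: mem_box Basis_prod_def)+
    then have "p \<in> unit_simplex" by (cases p) auto
    then have "psi S i (param S T p)
        = (1 - fst p - snd p) * axis i 1 $ a + fst p * axis i 1 $ b + snd p * axis i (1::real) $ c"
      using aff[OF T(1) param_in_cell] tri_affine_param[OF S T(1)[unfolded abc]] by (simp add: abc)
    then show "1/6 \<le> psi S i (param S T p)"
      using p T(2) by (auto simp: abc verts_def axis_def)
  qed (use nn[OF T(1)] in auto)
  then show ?thesis using nn by (intro mesh_integral_pos[OF _ T(1)])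
qed

section \<open>Linearity of the recovered derivatives\<close>

definition lsq_fit :: "('v::finite, 't::finite, 'b) ot_data \<Rightarrow> 'v \<Rightarrow> real^'v \<Rightarrow> real^6" where
  "lsq_fit S i u = (ARG_MIN (\<lambda>c. \<Sum>k\<in>patch S i. (c \<bullet> quad_monomials (loc S i k) - u $ k)\<^sup>2) c. True)"

lemma q_fit_lsq: "q_fit S i u = (\<lambda>\<xi>. lsq_fit S i u \<bullet> quad_monomials \<xi>)"
  by (simp add: q_fit_def lsq_fit_def)

lemma arg_min_eqI:
  fixes N :: "'a \<Rightarrow> real"
  assumes "\<And>y. y \<noteq> x \<Longrightarrow> N x < N y"
  shows "(ARG_MIN N y. True) = x"
  unfolding arg_min_def is_arg_min_def
proof (rule some_equality)
  show "True \<and> (\<nexists>y. True \<and> N y < N x)" using assms by (metis less_asym)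
qed (use assms in blast)

text \<open>The normal equations characterise the least squares fit because the monomials at the
  patch vertices span the space of coefficient vectors.\<close>
lemma lsq_fit_eqI:
  assumes ok: "recovery_ok S"
    and ne: "\<And>d. (\<Sum>k\<in>patch S i. (c \<bullet> quad_monomials (loc S i k) - u $ k) * (d \<bullet> quad_monomials (loc S i k))) = 0"
  shows "lsq_fit S i u = c"
  unfolding lsq_fit_def
proof (rule arg_min_eqI)
  fix d :: "real^6" assume "d \<noteq> c"
  let ?m = "\<lambda>k. quad_monomials (loc S i k)"
  \<comment> \<open>A vanishing sum would put \<open>d - c\<close> into the kernel of the design
    matrix, which rank six excludes.\<close>
  have "0 < (\<Sum>k\<in>patch S i. ((d - c) \<bullet> ?m k)\<^sup>2)"
  proof (rule ccontr)
    assume "\<not> ?thesis"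
    moreover have "0 \<le> (\<Sum>k\<in>patch S i. ((d - c) \<bullet> ?m k)\<^sup>2)" by (simp add: sum_nonneg)
    ultimately have "(\<Sum>k\<in>patch S i. ((d - c) \<bullet> ?m k)\<^sup>2) = 0" by simp
    then have "\<forall>k\<in>patch S i. (d - c) \<bullet> ?m k = 0" by (simp add: sum_nonneg_eq_0_iff)
    then have "design S i *v (d - c) = 0"
      by (auto simp: vec_eq_iff matrix_vector_mul_component design_def inner_commute)
    moreover have "inj ((*v) (design S i))"
      using ok by (simp add: full_rank_injective[symmetric] recovery_ok_def)
    ultimately show False
      using \<open>d \<noteq> c\<close> by (metis injD matrix_vector_mult_0_right right_minus_eq)
  qed
  \<comment> \<open>Pythagoras: the cross term vanishes by the normal equations in the direction
    \<open>d - c\<close>.\<close>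
  moreover have "(\<Sum>k\<in>patch S i. (d \<bullet> ?m k - u $ k)\<^sup>2)
      = (\<Sum>k\<in>patch S i. (c \<bullet> ?m k - u $ k)\<^sup>2) + (\<Sum>k\<in>patch S i. ((d - c) \<bullet> ?m k)\<^sup>2)
        + 2 * (\<Sum>k\<in>patch S i. (c \<bullet> ?m k - u $ k) * ((d - c) \<bullet> ?m k))"
    unfolding sum_distrib_left sum.distrib[symmetric]
    by (rule sum.cong) (auto simp: inner_diff_left power2_eq_square algebra_simps)
  ultimately show "(\<Sum>k\<in>patch S i. (c \<bullet> ?m k - u $ k)\<^sup>2) < (\<Sum>k\<in>patch S i. (d \<bullet> ?m k - u $ k)\<^sup>2)"
    using ne[of "d - c"] by simp
qed

text \<open>The normal operator \<open>N\<close> is injective on a finite-dimensional space, hence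
  surjective, so the normal equations have a solution; by \<open>lsq_fit_eqI\<close> it is the
  fit.\<close>

lemma lsq_fit_normal_equations:
  assumes ok: "recovery_ok S"
  shows "(\<Sum>k\<in>patch S i. (lsq_fit S i u \<bullet> quad_monomials (loc S i k) - u $ k) *
    (d \<bullet> quad_monomials (loc S i k))) = 0"
proof -
  let ?m = "\<lambda>k. quad_monomials (loc S i k)"
  define N where "N c = (\<Sum>k\<in>patch S i. (c \<bullet> ?m k) *\<^sub>R ?m k)" for c
  have lin: "linear N"
    by (simp add: N_def linear_iff inner_add_left scaleR_add_left sum.distrib scaleR_sum_right)
  \<comment> \<open>A kernel vector solves the normal equations for zero data, as does 0, and both
    must equal the fit of zero data.\<close>
  have "inj N"
  proof (rule linear_injective_0[OF lin, THEN iffD2], intro allI impI)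
    fix c assume "N c = 0"
    then have "d \<bullet> N c = 0" for d by simp
    then have "lsq_fit S i 0 = c"
      by (intro lsq_fit_eqI[OF ok]) (simp add: N_def inner_sum_right)
    moreover have "lsq_fit S i 0 = 0" by (rule lsq_fit_eqI[OF ok]) simp
    ultimately show "c = 0" by simp
  qed
  then have "surj N" using linear_injective_imp_surjective[OF lin] by auto
  then obtain c where c: "N c = (\<Sum>k\<in>patch S i. u $ k *\<^sub>R ?m k)" by (metis surjD)
  have *: "(\<Sum>k\<in>patch S i. (c \<bullet> ?m k - u $ k) * (d \<bullet> ?m k)) = 0" for d
  proof -
    have "d \<bullet> N c = d \<bullet> (\<Sum>k\<in>patch S i. u $ k *\<^sub>R ?m k)" by (simp add: c)
    then show ?thesis
      by (simp add: N_def inner_sum_right left_diff_distrib sum_subtractf)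
  qed
  then have "lsq_fit S i u = c" by (rule lsq_fit_eqI[OF ok])
  with * show ?thesis by simp
qed

text \<open>The normal equations are linear jointly in coefficients and data, so sums and multiples
  of fits solve those of the combined data.\<close>

lemma linear_lsq_fit:
  assumes ok: "recovery_ok S"
  shows "linear (lsq_fit S i)"
proof (rule linearI; rule lsq_fit_eqI[OF ok])
  fix u v d
  let ?m = "\<lambda>k. quad_monomials (loc S i k)"
  show "(\<Sum>k\<in>patch S i. ((lsq_fit S i u + lsq_fit S i v) \<bullet> ?m k - (u + v) $ k) * (d \<bullet> ?m k)) = 0"
    using lsq_fit_normal_equations[OF ok, of i u d] lsq_fit_normal_equations[OF ok, of i v d]
    by (simp add: inner_add_left algebra_simps sum.distrib sum_subtractf)
next
  fix r u d
  let ?m = "\<lambda>k. quad_monomials (loc S i k)"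
  have "(\<Sum>k\<in>patch S i. ((r *\<^sub>R lsq_fit S i u) \<bullet> ?m k - (r *\<^sub>R u) $ k) * (d \<bullet> ?m k))
      = r * (\<Sum>k\<in>patch S i. (lsq_fit S i u \<bullet> ?m k - u $ k) * (d \<bullet> ?m k))"
    by (simp add: sum_distrib_left algebra_simps)
  then show "(\<Sum>k\<in>patch S i. ((r *\<^sub>R lsq_fit S i u) \<bullet> ?m k - (r *\<^sub>R u) $ k) * (d \<bullet> ?m k)) = 0"
    by (simp add: lsq_fit_normal_equations[OF ok])
qed

lemma quad_monomials_differentiable: "quad_monomials differentiable at 0"
proof -
  have nth: "(\<lambda>\<xi> :: real^2. \<xi> $ k) differentiable at 0" for k
    by (rule bounded_linear_imp_differentiable) (rule bounded_linear_vec_nth)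
  \<comment> \<open>Components of \<open>vector\<close> unfold to conditionals on the index, whose
    conditions do not depend on the planar variable.\<close>
  have cond: "(\<lambda>\<xi>. if c then f \<xi> else g \<xi>) differentiable at 0"
    if "f differentiable at 0" "g differentiable at 0" for c and f g :: "real^2 \<Rightarrow> real"
    using that by (cases c) simp_all
  have "(\<lambda>\<xi>. quad_monomials \<xi> $ j) differentiable at 0" for j
    unfolding quad_monomials_def vector_def
    by (simp add: fun_upd_def o_def power2_eq_square) (intro cond differentiable_mult nth differentiable_const; simp)
  then have "\<forall>j\<in>Basis. (\<lambda>\<xi>. quad_monomials \<xi> \<bullet> j) differentiable at 0"
    by (auto simp: Basis_vec_def inner_axis)
  then show ?thesis using differentiable_componentwise_within[of quad_monomials 0 UNIV] by simp
qed

text \<open>The monomials do not depend on the data, so nodal values enter the gradient only through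
  \<open>lsq_fit\<close>.\<close>

lemma grad_q_lsq:
  "grad_q S i u $ a = lsq_fit S i u \<bullet> frechet_derivative quad_monomials (at 0) (axis a 1)"
proof -
  have "(q_fit S i u has_derivative
      (\<lambda>h. lsq_fit S i u \<bullet> frechet_derivative quad_monomials (at 0) h)) (at 0)"
    unfolding q_fit_lsq
    by (rule has_derivative_inner_right)
      (simp add: frechet_derivative_works[symmetric] quad_monomials_differentiable)
  then have "frechet_derivative (q_fit S i u) (at 0)
      = (\<lambda>h. lsq_fit S i u \<bullet> frechet_derivative quad_monomials (at 0) h)"
    by (rule frechet_derivative_at[symmetric])
  then show ?thesis by (simp add: grad_q_def)
qed

lemma linear_grad_q:
  assumes "recovery_ok S"
  shows "linear (grad_q S i)"
  by (rule linearI) (simp_all add: vec_eq_iff grad_q_lsq inner_add_left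
      linear_add[OF linear_lsq_fit[OF assms]] linear_scale[OF linear_lsq_fit[OF assms]])

lemma linear_G_h:
  assumes "recovery_ok S"
  shows "linear (G_h S)"
  by (rule linearI) (simp_all add: vec_eq_iff G_h_def matrix_vector_right_distrib matrix_vector_mult_scaleR
      linear_add[OF linear_grad_q[OF assms]] linear_scale[OF linear_grad_q[OF assms]])

lemma linear_G_h_div: "linear (G_h_div S)"
proof (rule linearI)
  have "(\<chi> i. (m + m') $ i $ c) = (\<chi> i. m $ i $ c) + (\<chi> i. m' $ i $ c)" for m m' :: "real^3^'a" and c
    by (simp add: vec_eq_iff)
  then show "G_h_div S (m + m') = G_h_div S m + G_h_div S m'" for m m'
    by (simp add: G_h_div_def matrix_vector_right_distrib sum.distrib)
  have "(\<chi> i. (r *\<^sub>R m) $ i $ c) = r *\<^sub>R (\<chi> i. m $ i $ c)" for r and m :: "real^3^'a" and c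
    by (simp add: vec_eq_iff)
  then show "G_h_div S (r *\<^sub>R m) = r *\<^sub>R G_h_div S m" for r m
    by (simp add: G_h_div_def matrix_vector_mult_scaleR scaleR_sum_right)
qed

lemma linear_layer: "linear (\<lambda>u :: 'a::real_vector^'t::finite. layer S u j)"
  by (simp add: linear_iff layer_def)

lemma linear_G_tau: "linear (G_tau S)"
  by (simp add: linear_iff vec_eq_iff G_tau_def Let_def layer_def algebra_simps)

lemma linear_GG_h:
  assumes "recovery_ok S"
  shows "linear (GG_h S)"
  using linear_G_tau[of S] linear_G_h[OF assms]
  by (simp add: linear_iff GG_h_def vec_eq_iff)

text \<open>A recovered gradient lies in the range of \<open>Jac S i\<close>, to which the nodal
  normal is orthogonal.\<close>

lemma GG_h_in_X_h:
  assumes "normals_ok S"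
  shows "GG_h S u \<in> X_h S"
proof -
  have "nrm S i \<bullet> (G_h S v $ i) = 0" for v i
    using assms by (simp add: normals_ok_def G_h_def matrix_vector_mul_assoc[symmetric])
  then show ?thesis by (simp add: X_h_def GG_h_def)
qed

section \<open>Coordinates\<close>

lemma sum_range_inj:
  fixes f :: "'a::finite \<Rightarrow> 'b::real_vector"
  assumes "inj f"
  shows "(\<Sum>v\<in>range f. u v *\<^sub>R v) = (\<Sum>a\<in>UNIV. u (f a) *\<^sub>R f a)"
  by (simp add: sum.reindex[OF assms])

lemma span_range_sum:
  fixes f :: "'a::finite \<Rightarrow> 'b::real_vector"
  assumes "inj f" "y \<in> span (range f)"
  obtains c where "y = (\<Sum>a\<in>UNIV. c a *\<^sub>R f a)"
proof -
  have "span (range f) = range (\<lambda>u. \<Sum>v\<in>range f. u v *\<^sub>R v)" by (rule span_finite) simp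
  with assms(2) obtain u where "y = (\<Sum>v\<in>range f. u v *\<^sub>R v)" by auto
  then show ?thesis using that[of "u \<circ> f"] by (simp add: sum_range_inj[OF assms(1)])
qed

lemma independent_range_coeff_0:
  fixes f :: "'a::finite \<Rightarrow> 'b::real_vector"
  assumes "inj f" "independent (range f)" "(\<Sum>a\<in>UNIV. c a *\<^sub>R f a) = 0"
  shows "c a = 0"
proof -
  have "(\<Sum>v\<in>range f. c (inv f v) *\<^sub>R v) = 0"
    using assms by (simp add: sum_range_inj)
  then have "c (inv f (f a)) = 0"
    by (rule independentD[OF assms(2), rotated 2]) auto
  then show ?thesis by (simp add: assms(1))
qed

lemma linear_of_coords: "linear (of_coords S)"
  by (simp add: linear_iff of_coords_def vec_eq_iff scaleR_add_left sum.distrib scaleR_sum_right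
      sum_distrib_left algebra_simps)

text \<open>Density coordinates are the nodal values themselves; tangent coordinates are determined
  by independence of the basis \<open>tb\<close> at each vertex.\<close>

lemma inj_of_coords:
  fixes S :: "('v::finite, 't::finite, 'b) ot_data"
  assumes "normals_ok S"
  shows "inj (of_coords S)"
proof (rule linear_injective_0[OF linear_of_coords, THEN iffD2], intro allI impI)
  fix x assume x: "of_coords S x = 0"
  have tb: "inj (tb S i)" "independent (range (tb S i))" for i
    using assms by (simp_all add: normals_ok_def)
  have "x $ Inl (t, i) = 0" for t i
    using arg_cong[OF x, of "\<lambda>z. fst z $ t $ i"] by (simp add: of_coords_def)
  moreover have "x $ Inr (t, i, a) = 0" for t i a
  proof (rule independent_range_coeff_0[OF tb])
    show "(\<Sum>a\<in>UNIV. x $ Inr (t, i, a) *\<^sub>R tb S i a) = 0"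
      using arg_cong[OF x, of "\<lambda>z. snd z $ t $ i"] by (simp add: of_coords_def)
  qed
  ultimately have "x $ p = 0" for p by (cases p; force)
  then show "x = 0" by (simp add: vec_eq_iff)
qed

lemma of_coords_in_X_h:
  assumes "normals_ok S"
  shows "of_coords S x \<in> X_h S"
proof -
  have "nrm S i \<bullet> tb S i a = 0" for i a
  proof -
    have "tb S i a \<in> span (range (tb S i))" by (intro span_base) simp
    then show ?thesis using assms by (simp add: normals_ok_def)
  qed
  then show ?thesis by (simp add: X_h_def of_coords_def inner_sum_right)
qed

lemma of_coords_surj:
  assumes "normals_ok S" "z \<in> X_h S"
  obtains x where "z = of_coords S x"
proof -
  obtain \<rho> m where z: "z = (\<rho>, m)" by (cases z)
  have "\<exists>c. m $ t $ i = (\<Sum>a\<in>UNIV. c a *\<^sub>R tb S i a)" for t i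
  proof -
    have "inj (tb S i)" "m $ t $ i \<in> span (range (tb S i))"
      using assms by (auto simp: z X_h_def normals_ok_def)
    then show ?thesis using span_range_sum by metis
  qed
  then obtain c where c: "\<And>t i. m $ t $ i = (\<Sum>a\<in>UNIV. c t i a *\<^sub>R tb S i a)" by metis
  have "z = of_coords S (\<chi> p. case p of Inl (t, i) \<Rightarrow> \<rho> $ t $ i | Inr (t, i, a) \<Rightarrow> c t i a)"
    by (simp add: z of_coords_def vec_eq_iff c)
  then show ?thesis by (rule that)
qed

lemma coords_of_coords [simp]:
  assumes "normals_ok S"
  shows "coords S (of_coords S x) = x"
  unfolding coords_def by (rule the_equality) (use inj_of_coords[OF assms] in \<open>auto dest: injD\<close>)

lemma of_coords_coords:
  assumes "normals_ok S" "z \<in> X_h S"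
  shows "of_coords S (coords S z) = z"
  by (rule of_coords_surj[OF assms]) (simp add: assms)

text \<open>\<open>coords\<close> inverts the linear injection \<open>of_coords\<close> on its range
  \<open>X_h\<close> only, hence the membership premises.\<close>

lemma coords_add:
  assumes "normals_ok S" "z \<in> X_h S" "z' \<in> X_h S"
  shows "coords S (z + z') = coords S z + coords S z'"
  using of_coords_coords[OF assms(1,2)] of_coords_coords[OF assms(1,3)]
    coords_of_coords[OF assms(1), of "coords S z + coords S z'"]
  by (simp add: linear_add[OF linear_of_coords])

lemma coords_scaleR:
  assumes "normals_ok S" "z \<in> X_h S"
  shows "coords S (r *\<^sub>R z) = r *\<^sub>R coords S z"
  using of_coords_coords[OF assms] coords_of_coords[OF assms(1), of "r *\<^sub>R coords S z"]
  by (simp add: linear_scale[OF linear_of_coords])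

lemma linear_coords_compose:
  assumes "normals_ok S" "linear f" "\<And>x. f x \<in> X_h S"
  shows "linear (\<lambda>x. coords S (f x))"
  by (rule linearI)
    (simp_all add: linear_add[OF assms(2)] linear_scale[OF assms(2)] coords_add coords_scaleR assms)

section \<open>The discrete Poisson problem\<close>

lemma discretisation_props:
  assumes "ot_discretisation S"
  shows mesh_ok: "triangulated_surface S" and recovery: "recovery_ok S" and normals: "normals_ok S"
    and tau_pos: "0 < tau S" and wt_pos: "0 < wt S j"
  using assms by (auto simp: ot_discretisation_def tau_def wt_def)

lemma linear_sum_fun:
  assumes "\<And>j. j \<in> A \<Longrightarrow> linear (f j)"
  shows "linear (\<lambda>x. \<Sum>j\<in>A. f j x)"
  by (rule linearI)
    (simp_all add: linear_add[OF assms] linear_scale[OF assms] sum.distrib scaleR_sum_right)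

lemma linear_cmult:
  fixes f :: "'a::real_vector \<Rightarrow> real"
  assumes "linear f"
  shows "linear (\<lambda>x. c * f x)"
  by (rule linearI) (simp_all add: linear_add[OF assms] linear_scale[OF assms] algebra_simps)

lemma a_h_alt:
  assumes "ot_discretisation S"
  shows "a_h S u v =
     (\<Sum>j=1..Nt S. tau S *
        L2 S (S_fun S ((1 / tau S) *\<^sub>R (layer S u j - layer S u (j - 1))))
             (S_fun S ((1 / tau S) *\<^sub>R (layer S v j - layer S v (j - 1))))) +
     (\<Sum>j=0..Nt S. wt S j * stiffness S (layer S u j) (layer S v j))"
  by (simp add: a_h_def stiffness_surf_grad[OF mesh_ok[OF assms]])

lemma a_h_commute:
  assumes "ot_discretisation S"
  shows "a_h S u v = a_h S v u"
  by (simp add: a_h_alt[OF assms] L2_commute stiffness_commute)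

lemma linear_a_h:
  assumes "ot_discretisation S"
  shows "linear (\<lambda>u. a_h S u v)"
proof -
  note M = mesh_ok[OF assms]
  let ?d = "\<lambda>u j. (1 / tau S) *\<^sub>R (layer S u j - layer S u (j - 1))"
  have d: "linear (\<lambda>u. ?d u j)" for j
    by (simp add: linear_iff layer_def algebra_simps)
  have "linear (\<lambda>u. L2 S (S_fun S (?d u j)) (S_fun S w))" for j w
    using linear_compose[OF d linear_L2_S_fun[OF M continuous_on_S_fun[OF M]]] by (simp add: o_def)
  moreover have "linear (\<lambda>u. stiffness S (layer S u j) w)" for j w
    using linear_compose[OF linear_layer linear_stiffness[OF M]] by (simp add: o_def)
  ultimately show ?thesis
    unfolding a_h_alt[OF assms]
    by (intro linear_compose_add linear_sum_fun linear_cmult)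
qed

lemma node_surj:
  assumes "ot_discretisation S"
  obtains j where "j \<le> Nt S" "t = node S j"
proof -
  have "t \<in> node S ` {0..Nt S}"
    using assms by (simp add: ot_discretisation_def bij_betw_def)
  then show ?thesis using that by auto
qed

lemma a_h_definite:
  assumes ot: "ot_discretisation S" and v: "v \<in> V_h S" and a: "a_h S v v = 0"
  shows "v = 0"
proof -
  note M = mesh_ok[OF ot]
  let ?d = "\<lambda>j. (1 / tau S) *\<^sub>R (layer S v j - layer S v (j - 1))"
  let ?A = "mesh_integral S (\<lambda>T x. 1)"
  have nn1: "0 \<le> tau S * L2 S (S_fun S (?d j)) (S_fun S (?d j))" for j
    using tau_pos[OF ot] by (intro mult_nonneg_nonneg L2_self_nonneg) simp
  have nn2: "0 \<le> wt S j * stiffness S (layer S v j) (layer S v j)" for j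
    using wt_pos[OF ot, of j] by (intro mult_nonneg_nonneg stiffness_nonneg) simp
  let ?s1 = "\<Sum>j=1..Nt S. tau S * L2 S (S_fun S (?d j)) (S_fun S (?d j))"
  let ?s2 = "\<Sum>j=0..Nt S. wt S j * stiffness S (layer S v j) (layer S v j)"
  have "0 \<le> ?s1" "0 \<le> ?s2" by (intro sum_nonneg nn1 nn2)+
  moreover have "?s1 + ?s2 = 0" using a unfolding a_h_alt[OF ot] .
  ultimately have s: "?s1 = 0" "?s2 = 0" by linarith+
  have "stiffness S (layer S v j) (layer S v j) = 0" if "j \<le> Nt S" for j
  proof -
    have "wt S j * stiffness S (layer S v j) (layer S v j) = 0"
      by (rule sum_nonneg_0[OF _ nn2 s(2)]) (use that in auto)
    then show ?thesis using wt_pos[OF ot, of j] by simp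
  qed
  then have sp: "layer S v j $ i = layer S v j $ k" if "j \<le> Nt S" for i k j
    by (rule constant_if_stiffness_eq_0[OF M]) (use that in auto)
  \<comment> \<open>\<open>undefined\<close> serves as an arbitrary reference vertex, since each
    layer is constant.\<close>
  define c where "c j = layer S v j $ undefined" for j
  have c: "layer S v j $ i = c j" if "j \<le> Nt S" for i j
    unfolding c_def by (rule sp[OF that])
  \<comment> \<open>The time energy now controls one number per layer; \<open>j \<ge> 1\<close>
    makes \<open>j - 1\<close> a genuine predecessor.\<close>
  have step: "c j = c (j - 1)" if j: "j \<in> {1..Nt S}" for j
  proof -
    have "L2 S (S_fun S (?d j)) (S_fun S (?d j)) = 0"
    proof -
      have "tau S * L2 S (S_fun S (?d j)) (S_fun S (?d j)) = 0"
        by (rule sum_nonneg_0[OF _ nn1 s(1)]) (use j in auto)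
      then show ?thesis using tau_pos[OF ot] by simp
    qed
    moreover have dj: "?d j $ i = (1 / tau S) * (c j - c (j - 1))" for i
    proof -
      have "j - 1 \<le> Nt S" "j \<le> Nt S" using j by auto
      then show ?thesis using c[of j i] c[of "j - 1" i] by simp
    qed
    \<comment> \<open>The squared norm of the constant time difference is its square times the
      positive mesh area.\<close>
    ultimately have "((1 / tau S) * (c j - c (j - 1))) * ((1 / tau S) * (c j - c (j - 1))) * ?A = 0"
      using L2_S_fun_constant(1)[OF M dj dj] by simp
    then show ?thesis using mesh_area_pos[OF M] tau_pos[OF ot] by simp
  qed
  have c0: "c j = c 0" if "j \<le> Nt S" for j
    using that
  proof (induction j)
    case (Suc j)
    then show ?case using step[of "Suc j"] by simp
  qed simp
  \<comment> \<open>With a single constant left, the mean value condition says that its product with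
    the total time weight and the mesh area is zero.\<close>
  have "0 = (\<Sum>j=0..Nt S. wt S j * L2 S (S_fun S (layer S v j)) (\<lambda>x. 1))"
    using v by (simp add: V_h_def)
  also have "\<dots> = (\<Sum>j=0..Nt S. wt S j * (c 0 * ?A))"
  proof (rule sum.cong)
    fix j assume "j \<in> {0..Nt S}"
    then have vj: "layer S v j $ i = c 0" for i using c[of j i] c0[of j] by simp
    show "wt S j * L2 S (S_fun S (layer S v j)) (\<lambda>x. 1) = wt S j * (c 0 * ?A)"
      using L2_S_fun_constant(2)[OF M vj vj] by simp
  qed simp
  also have "\<dots> = (\<Sum>j=0..Nt S. wt S j) * (c 0 * ?A)" by (simp add: sum_distrib_right)
  finally have "(\<Sum>j=0..Nt S. wt S j) * (c 0 * ?A) = 0" by simp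
  moreover have "0 < (\<Sum>j=0..Nt S. wt S j)"
    by (rule sum_pos) (use wt_pos[OF ot] in auto)
  ultimately have z: "c 0 = 0" using mesh_area_pos[OF M] by simp
  have "v $ t $ i = 0" for t i
  proof -
    obtain j where "j \<le> Nt S" "t = node S j" by (rule node_surj[OF ot])
    then show ?thesis using c[of j i] c0[of j] z by (simp add: layer_def)
  qed
  then show ?thesis by (simp add: vec_eq_iff)
qed

lemma linear_ell_h_test:
  assumes "ot_discretisation S"
  shows "linear (ell_h S z)"
proof -
  note M = mesh_ok[OF assms]
  have "linear (\<lambda>v. L2 S (S_fun S w) (S_fun S (layer S v j)))" for j w
    unfolding L2_commute[of S "S_fun S w"]
    using linear_compose[OF linear_layer linear_L2_S_fun[OF M continuous_on_S_fun[OF M]]]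
    by (simp add: o_def)
  then show ?thesis
    unfolding ell_h_def by (intro linear_sum_fun linear_cmult)
qed

text \<open>The load is affine in \<open>z\<close>: the recovered derivatives are linear, and only
  the endpoint term has a constant part, which the value at 0 removes.\<close>

lemma linear_ell_h_load:
  assumes "ot_discretisation S"
  shows "linear (\<lambda>z. ell_h S z v - ell_h S 0 v)"
proof -
  note M = mesh_ok[OF assms]
  let ?N = "\<lambda>z j. layer S (G_tau S (fst z)) j + G_h_div S (layer S (snd z) j) + endpoint_term S z j"
  have L: "linear (\<lambda>u. L2 S (S_fun S u) (S_fun S (layer S v j)))" for j
    by (rule linear_L2_S_fun[OF M continuous_on_S_fun[OF M]])
  have "linear (\<lambda>z. layer S (G_tau S (fst z)) j)" for j
    using linear_compose[OF linear_fst linear_compose[OF linear_G_tau linear_layer]]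
    by (simp add: o_def)
  moreover have "linear (\<lambda>z. G_h_div S (layer S (snd z) j))" for j
    using linear_compose[OF linear_snd linear_compose[OF linear_layer linear_G_h_div]]
    by (simp add: o_def)
  moreover have "linear (\<lambda>z. endpoint_term S z j - endpoint_term S 0 j)" for j
    by (auto simp: linear_iff endpoint_term_def layer_def algebra_simps)
  ultimately have "linear (\<lambda>z. layer S (G_tau S (fst z)) j + G_h_div S (layer S (snd z) j)
      + (endpoint_term S z j - endpoint_term S 0 j))" for j
    by (intro linear_compose_add)
  moreover have "layer S (G_tau S (fst z)) j + G_h_div S (layer S (snd z) j)
      + (endpoint_term S z j - endpoint_term S 0 j) = ?N z j - ?N 0 j" for z j
    using linear_0[OF linear_G_tau[of S]] linear_0[OF linear_G_h_div[of S]] by (simp add: layer_def)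
  ultimately have N: "linear (\<lambda>z. ?N z j - ?N 0 j)" for j by simp
  have "ell_h S z v - ell_h S 0 v
      = (\<Sum>j=0..Nt S. wt S j * L2 S (S_fun S (?N z j - ?N 0 j)) (S_fun S (layer S v j)))" for z
    unfolding ell_h_def sum_subtractf[symmetric] right_diff_distrib[symmetric]
    by (simp only: linear_diff[OF L])
  moreover have "linear (\<lambda>z. L2 S (S_fun S (?N z j - ?N 0 j)) (S_fun S (layer S v j)))" for j
    using linear_compose[OF N L] by (simp add: o_def)
  ultimately show ?thesis by (simp only: linear_sum_fun linear_cmult)
qed

section \<open>Solving the Poisson problem in a basis of \<open>V_h\<close>\<close>

lemma matrix_inv_right:
  fixes A :: "real^'n^'n"
  assumes "\<And>x. A *v x = 0 \<Longrightarrow> x = 0"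
  shows "A ** matrix_inv A = mat 1"
proof -
  \<comment> \<open>\<open>matrix_inv\<close> is a choice, so a two-sided inverse must exist first;
    for a square matrix a trivial kernel provides it.\<close>
  have "\<exists>B. A ** B = mat 1 \<and> B ** A = mat 1"
    using assms matrix_left_invertible_ker[of A] matrix_left_right_inverse[of A] by blast
  then show ?thesis unfolding matrix_inv_def by (rule someI2_ex) simp
qed

definition V_comb :: "('v::finite, 't::finite, 'b::finite) ot_data \<Rightarrow> real^'b \<Rightarrow> real^'v^'t" where
  "V_comb S y = (\<Sum>k\<in>UNIV. y $ k *\<^sub>R vb S k)"

lemma linear_V_comb: "linear (V_comb S)"
  by (simp add: linear_iff V_comb_def scaleR_add_left sum.distrib scaleR_sum_right)

lemma linear_of_V_comb:
  assumes "linear f"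
  shows "f (V_comb S y) = (\<Sum>k\<in>UNIV. y $ k *\<^sub>R f (vb S k))"
  by (simp add: V_comb_def linear_sum[OF assms] linear_scale[OF assms])

lemma V_h_span:
  assumes "ot_discretisation S"
  shows "V_h S = span (range (vb S))"
  using assms by (simp add: ot_discretisation_def)

lemma V_comb_in_V_h:
  assumes "ot_discretisation S"
  shows "V_comb S y \<in> V_h S"
  unfolding V_h_span[OF assms] V_comb_def by (intro span_sum span_scale span_base) simp

lemma a_h_V_comb:
  assumes "ot_discretisation S"
  shows "a_h S (V_comb S y) (vb S k) = (L_mat S *v y) $ k"
  using linear_of_V_comb[OF linear_a_h[OF assms, of "vb S k"], of S y]
  by (simp add: L_mat_def matrix_vector_mult_def mult.commute)

text \<open>Testing a kernel combination against every basis vector and recombining gives it zero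
  energy; definiteness and independence of the basis then annihilate the coefficients.\<close>

lemma L_mat_injective:
  assumes "ot_discretisation S" "L_mat S *v y = 0"
  shows "y = 0"
proof -
  have "a_h S (vb S k) (V_comb S y) = 0" for k
    using a_h_V_comb[OF assms(1), of y k] assms(2) by (simp add: a_h_commute[OF assms(1)])
  then have "a_h S (V_comb S y) (V_comb S y) = 0"
    using linear_of_V_comb[OF linear_a_h[OF assms(1), of "V_comb S y"], of S y] by simp
  then have "V_comb S y = 0"
    by (rule a_h_definite[OF assms(1) V_comb_in_V_h[OF assms(1)]])
  then have "y $ k = 0" for k
    using assms(1) unfolding V_comb_def
    by (intro independent_range_coeff_0[of "vb S" "($) y"]) (auto simp: ot_discretisation_def)
  then show ?thesis by (simp add: vec_eq_iff)
qed

text \<open>Agreement on basis vectors extends to all test functions in \<open>V_h\<close> by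
  linearity; definiteness makes the solution unique, so the description in \<open>phi_sol\<close> is
  resolved.\<close>

lemma phi_sol_eq:
  assumes ot: "ot_discretisation S"
  shows "phi_sol S z = V_comb S (matrix_inv (L_mat S) *v load S z)"
proof -
  let ?y = "matrix_inv (L_mat S) *v load S z"
  have "L_mat S ** matrix_inv (L_mat S) = mat 1"
    by (rule matrix_inv_right) (rule L_mat_injective[OF ot])
  then have y: "L_mat S *v ?y = load S z" by (simp add: matrix_vector_mul_assoc)
  have sol: "a_h S (V_comb S ?y) v = ell_h S z v" if "v \<in> V_h S" for v
  proof -
    from that have "v \<in> span (range (vb S))" by (simp add: V_h_span[OF ot])
    then show ?thesis
    proof (rule linear_eq_on_span[rotated 3])
      have "a_h S (V_comb S ?y) = (\<lambda>u. a_h S u (V_comb S ?y))"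
        by (rule ext) (rule a_h_commute[OF ot])
      then show "linear (a_h S (V_comb S ?y))"
        using linear_a_h[OF ot, of "V_comb S ?y"] by (simp only:)
      show "linear (ell_h S z)" by (rule linear_ell_h_test[OF ot])
      fix w assume "w \<in> range (vb S)"
      then show "a_h S (V_comb S ?y) w = ell_h S z w"
        using a_h_V_comb[OF ot, of ?y] y by (auto simp: load_def)
    qed
  qed
  show ?thesis unfolding phi_sol_def
  proof (rule the_equality)
    show "V_comb S ?y \<in> V_h S \<and> (\<forall>v\<in>V_h S. a_h S (V_comb S ?y) v = ell_h S z v)"
      using sol V_comb_in_V_h[OF ot] by blast
    fix \<phi> assume \<phi>: "\<phi> \<in> V_h S \<and> (\<forall>v\<in>V_h S. a_h S \<phi> v = ell_h S z v)"
    let ?e = "\<phi> - V_comb S ?y"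
    have e: "?e \<in> V_h S"
      using \<phi> V_comb_in_V_h[OF ot, of ?y] unfolding V_h_span[OF ot] by (blast intro: span_diff)
    have "a_h S ?e ?e = a_h S \<phi> ?e - a_h S (V_comb S ?y) ?e"
      by (rule linear_diff[OF linear_a_h[OF ot]])
    then have "a_h S ?e ?e = 0" using \<phi> sol e by simp
    then have "?e = 0" by (rule a_h_definite[OF ot e])
    then show "\<phi> = V_comb S ?y" by simp
  qed
qed

section \<open>The recovered update in coordinates\<close>

lemma matrix_mult_linear:
  fixes f :: "real^'n \<Rightarrow> real^'m"
  assumes "linear f"
  shows "matrix f *v x = f x"
  using matrix_vector_mul(2)[OF assms] by (rule fun_cong)

lemma load_of_coords:
  assumes "ot_discretisation S"
  shows "load S (of_coords S x) = D_mat S *v x + c_vec S"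
proof -
  have "linear (\<lambda>z. load S z - c_vec S)"
  proof (rule linearI)
    show "load S (z + z') - c_vec S = (load S z - c_vec S) + (load S z' - c_vec S)" for z z'
      using linear_add[OF linear_ell_h_load[OF assms]] by (simp add: vec_eq_iff load_def c_vec_def)
    show "load S (r *\<^sub>R z) - c_vec S = r *\<^sub>R (load S z - c_vec S)" for r z
      using linear_scale[OF linear_ell_h_load[OF assms]] by (simp add: vec_eq_iff load_def c_vec_def)
  qed
  from linear_compose[OF linear_of_coords[of S] this]
  show ?thesis by (simp add: D_mat_def matrix_mult_linear o_def)
qed

lemma G_mat_mult:
  assumes "ot_discretisation S"
  shows "G_mat S *v y = coords S (GG_h S (V_comb S y))"
proof -
  have "linear (\<lambda>y. coords S (GG_h S (V_comb S y)))"
    using linear_coords_compose[OF normals[OF assms]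
        linear_compose[OF linear_V_comb linear_GG_h[OF recovery[OF assms]]]]
      GG_h_in_X_h[OF normals[OF assms]] by (simp add: o_def)
  then show ?thesis unfolding G_mat_def V_comb_def[symmetric] by (rule matrix_mult_linear)
qed

lemma outer_product_mult:
  fixes v :: "real^'m" and w :: "real^'n"
  shows "(\<chi> i j. v $ i * w $ j) *v x = (w \<bullet> x) *\<^sub>R v"
  by (simp add: vec_eq_iff matrix_vector_mult_def inner_vec_def sum_distrib_left mult_ac)

lemma Proj_mult: "Proj S i *v y = y - (nrm S i \<bullet> y) *\<^sub>R nrm S i"
  by (simp add: Proj_def matrix_vector_mult_diff_rdistrib outer_product_mult)

lemma R_map_in_X_h:
  assumes "normals_ok S"
  shows "R_map S z \<in> X_h S"
proof -
  have "nrm S i \<bullet> nrm S i = 1" for i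
    using assms by (simp add: normals_ok_def dot_square_norm)
  then show ?thesis by (simp add: X_h_def R_map_def Proj_mult inner_diff_right)
qed

text \<open>\<open>R_map\<close> is affine, while \<open>coords\<close> is additive only on
  \<open>X_h\<close>. Both \<open>R_map S z - R_map S 0\<close> and \<open>R_map S 0\<close> lie
  there, so the constant part splits off.\<close>

lemma R_map_of_coords:
  assumes n: "normals_ok S"
  shows "coords S (R_map S (of_coords S x)) = R_mat S *v x + r_vec S"
proof -
  have mem: "R_map S z - R_map S 0 \<in> X_h S" for z
    using R_map_in_X_h[OF n, of z] R_map_in_X_h[OF n, of 0]
    by (auto simp: X_h_def inner_diff_right)
  have "linear (\<lambda>z. R_map S z - R_map S 0)"
    by (simp add: linear_iff R_map_def vec_eq_iff matrix_vector_right_distrib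
        matrix_vector_mult_scaleR)
  from linear_coords_compose[OF n linear_compose[OF linear_of_coords this]] mem
  have "linear (\<lambda>x. coords S (R_map S (of_coords S x) - R_map S 0))" by (simp add: o_def)
  moreover have "coords S (R_map S z - R_map S 0) = coords S (R_map S z) - r_vec S" for z
    using coords_add[OF n mem R_map_in_X_h[OF n, of 0], of z] by (simp add: r_vec_def)
  ultimately show ?thesis by (simp add: R_mat_def matrix_mult_linear)
qed

lemma P_upd_in_X_h:
  assumes "normals_ok S"
  shows "P_upd S z \<in> X_h S"
  using assms by (simp add: P_upd_def R_map_in_X_h)

text \<open>Inserting the Poisson solution gives \<open>x + G L^-1 (D x + c)\<close>, which is
  \<open>U x + q\<close>; applying the affine \<open>R_map\<close> produces \<open>H_mat\<close> and
  \<open>k_vec\<close>.\<close>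

lemma coords_P_upd:
  assumes ot: "ot_discretisation S" and z: "z \<in> X_h S"
  shows "coords S (P_upd S z) = H_mat S *v coords S z + k_vec S"
proof -
  note n = normals[OF ot]
  define x where "x = coords S z"
  let ?y = "matrix_inv (L_mat S) *v load S z"
  have zx: "z = of_coords S x" by (simp add: x_def of_coords_coords[OF n z])
  have "GG_h S (phi_sol S z) = of_coords S (G_mat S *v ?y)"
    by (simp add: phi_sol_eq[OF ot] G_mat_mult[OF ot] of_coords_coords[OF n GG_h_in_X_h[OF n]])
  then have "z + GG_h S (phi_sol S z) = of_coords S (x + G_mat S *v ?y)"
    by (simp add: zx linear_add[OF linear_of_coords])
  moreover have "x + G_mat S *v ?y = U_mat S *v x + q_vec S"
    by (simp add: zx load_of_coords[OF ot] U_mat_def q_vec_def matrix_vector_right_distrib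
        matrix_vector_mult_add_rdistrib matrix_vector_mul_assoc matrix_mul_assoc)
  ultimately have "coords S (P_upd S z) = R_mat S *v (U_mat S *v x + q_vec S) + r_vec S"
    by (simp add: P_upd_def R_map_of_coords[OF n])
  then show ?thesis
    by (simp add: H_mat_def k_vec_def x_def matrix_vector_right_distrib matrix_vector_mul_assoc)
qed

section \<open>The metric and oblique projections\<close>

lemma linear_X_inner: "linear (\<lambda>z. X_inner S z z')"
  unfolding X_inner_def
  by (intro linear_sum_fun linear_cmult)
    (simp add: linear_iff layer_def inner_add_left algebra_simps)

lemma X_inner_commute: "X_inner S z z' = X_inner S z' z"
  by (simp add: X_inner_def inner_commute mult.commute)

lemma W_h_mult_component:
  "(W_h S *v y) $ p = X_inner S (of_coords S (axis p 1)) (of_coords S y)"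
proof -
  have "linear (\<lambda>y. X_inner S (of_coords S y) (of_coords S (axis p 1)))"
    using linear_compose[OF linear_of_coords linear_X_inner] by (simp add: o_def)
  from linear_eq_sum_axis[OF this, of y] show ?thesis
    by (simp add: W_h_def matrix_vector_mult_def X_inner_commute[of S _ "of_coords S (axis p 1)"]
        mult.commute)
qed

text \<open>Transfers definiteness of the metric on fields to its coordinate matrix.\<close>

lemma W_h_inner: "x \<bullet> (W_h S *v y) = X_inner S (of_coords S x) (of_coords S y)"
proof -
  have "linear (\<lambda>x. X_inner S (of_coords S x) (of_coords S y))"
    using linear_compose[OF linear_of_coords linear_X_inner] by (simp add: o_def)
  from linear_eq_sum_axis[OF this, of x] show ?thesis
    by (simp add: inner_vec_def W_h_mult_component)
qed

text \<open>Every nodal term is a positive weight times a sum of squares, and the time levels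
  exhaust the index type, so all nodal values vanish.\<close>

lemma X_inner_definite:
  assumes ot: "ot_discretisation S" and "X_inner S z z = 0"
  shows "z = 0"
proof -
  let ?w = "\<lambda>j i. wt S j * mesh_integral S (\<lambda>T. psi S i)"
  let ?f = "\<lambda>j i. layer S (fst z) j $ i * layer S (fst z) j $ i + (layer S (snd z) j $ i) \<bullet> (layer S (snd z) j $ i)"
  have w: "0 < ?w j i" for i j using wt_pos[OF ot] psi_integral_pos[OF mesh_ok[OF ot]] by simp
  have f: "0 \<le> ?f j i" for i j by simp
  have nn: "0 \<le> ?w j i * ?f j i" for i j by (rule mult_nonneg_nonneg[OF less_imp_le[OF w] f])
  have "(\<Sum>j=0..Nt S. \<Sum>i\<in>UNIV. ?w j i * ?f j i) = 0" using assms(2) by (simp only: X_inner_def)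
  then have "\<forall>j\<in>{0..Nt S}. (\<Sum>i\<in>UNIV. ?w j i * ?f j i) = 0"
    by (subst (asm) sum_nonneg_eq_0_iff) (auto intro!: sum_nonneg nn simp del: mult_eq_0_iff)
  then have "\<forall>j\<in>{0..Nt S}. \<forall>i\<in>UNIV. ?w j i * ?f j i = 0"
    by (subst (asm) sum_nonneg_eq_0_iff) (auto intro!: nn simp del: mult_eq_0_iff)
  then have "?w j i * ?f j i = 0" if "j \<le> Nt S" for i j
    using that by (meson UNIV_I atLeastAtMost_iff le0)
  then have fz: "?f j i = 0" if "j \<le> Nt S" for i j
    using that w[of j i] by (metis mult_eq_0_iff less_irrefl)
  have "fst z $ t $ i = 0 \<and> snd z $ t $ i = 0" for t i
  proof -
    obtain j where j: "j \<le> Nt S" "t = node S j" by (rule node_surj[OF ot])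
    from fz[OF j(1), of i] show ?thesis
      by (subst (asm) add_nonneg_eq_0_iff) (auto simp: layer_def j(2))
  qed
  then show ?thesis by (simp add: prod_eq_iff vec_eq_iff)
qed

text \<open>Ensures that \<open>W_h\<close> does not annihilate the direction of the oblique
  projection.\<close>

lemma W_h_injective:
  assumes "ot_discretisation S" "W_h S *v x = 0"
  shows "x = 0"
proof -
  have "X_inner S (of_coords S x) (of_coords S x) = 0"
    using assms(2) by (simp add: W_h_inner[symmetric])
  then have "of_coords S x = 0" by (rule X_inner_definite[OF assms(1)])
  then show ?thesis
    using inj_of_coords[OF normals[OF assms(1)]] linear_of_coords linear_injective_0 by blast
qed

section \<open>Oblique projections onto a kernel direction of the constraint matrix\<close>

lemma A_mat_kernel_nontrivial:
  fixes S :: "('v::finite, 't::finite, 'b::finite) ot_data"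
  assumes "ot_discretisation S"
  obtains v where "v \<noteq> 0" "A_mat S *v v = 0"
proof -
  have "CARD('t) = card {0..Nt S}"
    using assms bij_betw_same_card by (fastforce simp: ot_discretisation_def)
  then have t: "3 \<le> CARD('t)" using assms by (simp add: ot_discretisation_def)
  \<comment> \<open>Equations against unknowns: the weak equations are as many as the densities, and
    with at least three time levels the endpoint equations are fewer than the tangent
    coordinates.\<close>
  have "CARD('t) * CARD('v) + (CARD('v) + CARD('v)) < CARD('t) * CARD('v) + CARD('t) * (CARD('v) * 2)"
    using mult_le_mono1[OF t, of "CARD('v)"] zero_less_card_finite[where 'a='v] by linarith
  then have "CARD(('t \<times> 'v) + ('v + 'v)) < CARD(('t \<times> 'v) + ('t \<times> 'v \<times> 2))" by simp
  then have "rank (A_mat S) \<noteq> CARD(('t \<times> 'v) + ('t \<times> 'v \<times> 2))"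
    using rank_bound[of "A_mat S"] by linarith
  then show ?thesis using that matrix_nonfull_linear_equations_eq[of "A_mat S"] by blast
qed

text \<open>The rank-one matrix \<open>v w\<^sup>T\<close> with \<open>w \<bullet> v = 1\<close> projects onto the line through \<open>v\<close> along the
  hyperplane orthogonal to \<open>w\<close>, which is orthogonal in the metric \<open>W\<close> only when \<open>w\<close> is a multiple
  of \<open>W v\<close>; in dimension at least two some \<open>w\<close> avoids this.\<close>
lemma exists_oblique_projection:
  fixes A :: "real^'n^'m" and W :: "real^'n^'n"
  assumes v: "v \<noteq> 0" "A *v v = 0" and W: "W *v v \<noteq> 0" and dim: "2 \<le> CARD('n)"
  shows "\<exists>H k. A ** H = 0 \<and> A *v k = A *v x0 \<and> H ** H = H \<and> H *v k = 0 \<and>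
    \<not> orthogonal_projection_onto W (\<lambda>x. H *v x + k) (range (\<lambda>x. H *v x + k)) \<and>
    \<not> orthogonal_projection_onto W (\<lambda>x. H *v x + k) {x. A *v x = A *v x0}"
proof -
  have "2 \<le> DIM(real^'n)" using dim by simp
  then obtain u where "u \<noteq> 0" "orthogonal v u" by (rule orthogonal_to_vector_exists)
  then have u: "u \<noteq> 0" "v \<bullet> u = 0" by (simp_all add: orthogonal_def)
  \<comment> \<open>Two candidates are normalised on \<open>v\<close> and differ by
    \<open>u\<close>. If both failed, then \<open>v \<bullet> (W *v v) = 0\<close>, and so
    \<open>W *v v = 0\<close>.\<close>
  obtain w where w: "w \<bullet> v = 1" and nw: "W *v v \<noteq> (v \<bullet> (W *v v)) *\<^sub>R w"
  proof -
    let ?w = "(1 / (v \<bullet> v)) *\<^sub>R v"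
    have "?w \<bullet> v = 1" "(?w + u) \<bullet> v = 1"
      using v u(2) by (simp_all add: inner_add_left inner_commute[of u v])
    moreover have "W *v v \<noteq> (v \<bullet> (W *v v)) *\<^sub>R ?w \<or> W *v v \<noteq> (v \<bullet> (W *v v)) *\<^sub>R (?w + u)"
    proof (rule ccontr)
      assume "\<not> ?thesis"
      then have eq: "W *v v = (v \<bullet> (W *v v)) *\<^sub>R ?w" "W *v v = (v \<bullet> (W *v v)) *\<^sub>R (?w + u)"
        by blast+
      then have "(v \<bullet> (W *v v)) *\<^sub>R u = 0" by (simp only: scaleR_right_distrib) simp
      then have "v \<bullet> (W *v v) = 0" using u by simp
      with eq(1) W show False by (metis scaleR_zero_left)
    qed
    ultimately show ?thesis using that by blast
  qed
  define H where "H = (\<chi> i j. v $ i * w $ j)"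
  have H: "H *v x = (w \<bullet> x) *\<^sub>R v" for x
    unfolding H_def by (rule outer_product_mult)
  \<comment> \<open>\<open>x0\<close> is moved along \<open>v\<close> into the hyperplane orthogonal
    to \<open>w\<close>: its image under \<open>A\<close> is unchanged, and \<open>H\<close>
    annihilates the result.\<close>
  define k where "k = x0 - (w \<bullet> x0) *\<^sub>R v"
  let ?P = "\<lambda>x. H *v x + k"
  have Hk: "H *v k = 0" by (simp add: H k_def inner_diff_right w)
  have HH: "H ** H = H"
    by (simp add: matrix_eq matrix_vector_mul_assoc[symmetric] H w)
  have AH: "A ** H = 0"
    by (simp add: matrix_eq matrix_vector_mul_assoc[symmetric] H matrix_vector_mult_scaleR v)
  have Ak: "A *v k = A *v x0"
    by (simp add: k_def matrix_vector_mult_diff_distrib matrix_vector_mult_scaleR v)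
  \<comment> \<open>Allowing any \<open>C\<close> that contains the range covers both the range
    itself and the constraint set.\<close>
  have not_orth: "\<not> orthogonal_projection_onto W ?P C" if C: "range ?P \<subseteq> C" for C
  proof
    assume orth: "orthogonal_projection_onto W ?P C"
    \<comment> \<open>Replacing \<open>x\<close> by \<open>x + v\<close> moves the output by exactly
      \<open>v\<close>, so every residual would be \<open>W\<close>-orthogonal to
      \<open>v\<close>.\<close>
    have orth_line: "(x - ?P x) \<bullet> (W *v v) = 0" for x
    proof -
      have "?P (x + v) \<in> C" using C by blast
      moreover have "?P (x + v) - ?P x = v"
        by (simp add: H inner_add_right w scaleR_left_distrib)
      ultimately show ?thesis using orth unfolding orthogonal_projection_onto_def by metis
    qed
    \<comment> \<open>Removing the constant part leaves an identity linear in \<open>x\<close>,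
      which would make \<open>W *v v\<close> the multiple of \<open>w\<close> excluded by the choice
      of \<open>w\<close>.\<close>
    have "k \<bullet> (W *v v) = 0" using orth_line[of 0] by (simp add: H)
    then have "x \<bullet> (W *v v - (v \<bullet> (W *v v)) *\<^sub>R w) = 0" for x
      using orth_line[of x]
      by (simp add: H inner_diff_left inner_diff_right inner_add_left inner_commute[of x w])
    then have "W *v v - (v \<bullet> (W *v v)) *\<^sub>R w = 0" using inner_eq_zero_iff by blast
    with nw show False by simp
  qed
  have "range ?P \<subseteq> {x. A *v x = A *v x0}"
    by (auto simp: matrix_vector_right_distrib H matrix_vector_mult_scaleR v Ak)
  then show ?thesis using AH Ak HH Hk not_orth by (intro exI[of _ H] exI[of _ k]) blast
qed

text \<open>The last conjunct makes the failure of the implication concrete: for the actual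
  \<open>A_mat\<close> and \<open>W_h\<close> and every attainable right-hand side, some
  \<open>H\<close> and \<open>k\<close> meet all four conditions without giving an orthogonal
  projection, either onto the range of the map or onto the constraint set. For
  \<open>b_vec S\<close>, attainability means that the constraint set is nonempty.\<close>

theorem proposition5p2:
  fixes S :: "('v::finite, 't::finite, 'b::finite) ot_data"
  assumes "ot_discretisation S"
  shows
    "(\<forall>z\<in>X_h S.
        A_mat S *v coords S (P_upd S z) - b_vec S
          = (A_mat S ** H_mat S) *v coords S z + A_mat S *v k_vec S - b_vec S \<and>
        coords S (P_upd S (P_upd S z)) - coords S (P_upd S z)
          = (H_mat S ** H_mat S - H_mat S) *v coords S z + H_mat S *v k_vec S) \<and>
     ((\<forall>z\<in>X_h S. A_mat S *v coords S (P_upd S z) = b_vec S) \<longrightarrow>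
        A_mat S ** H_mat S = 0 \<and> A_mat S *v k_vec S = b_vec S) \<and>
     ((\<forall>z\<in>X_h S. P_upd S (P_upd S z) = P_upd S z) \<longrightarrow>
        H_mat S ** H_mat S = H_mat S \<and> H_mat S *v k_vec S = 0) \<and>
     (\<forall>b. (\<exists>x. A_mat S *v x = b) \<longrightarrow>
        (\<exists>H k. A_mat S ** H = 0 \<and> A_mat S *v k = b \<and> H ** H = H \<and> H *v k = 0 \<and>
           \<not> orthogonal_projection_onto (W_h S) (\<lambda>x. H *v x + k) (range (\<lambda>x. H *v x + k)) \<and>
           \<not> orthogonal_projection_onto (W_h S) (\<lambda>x. H *v x + k) {x. A_mat S *v x = b}))"
proof -
  note ot = assms
  note n = normals[OF ot]
  note P = coords_P_upd[OF ot]
  have PX: "P_upd S z \<in> X_h S" for z by (rule P_upd_in_X_h[OF n])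
  have residual: "A_mat S *v coords S (P_upd S z) - b_vec S
      = (A_mat S ** H_mat S) *v coords S z + A_mat S *v k_vec S - b_vec S" if "z \<in> X_h S" for z
    by (simp add: P[OF that] matrix_vector_right_distrib matrix_vector_mul_assoc)
  have defect: "coords S (P_upd S (P_upd S z)) - coords S (P_upd S z)
      = (H_mat S ** H_mat S - H_mat S) *v coords S z + H_mat S *v k_vec S" if "z \<in> X_h S" for z
    by (simp add: P[OF PX] P[OF that] matrix_vector_right_distrib matrix_vector_mul_assoc
        matrix_vector_mult_diff_rdistrib)
  \<comment> \<open>Every coordinate vector comes from a field in \<open>X_h\<close>, so the affine
    expression vanishes everywhere; its value at 0 gives the constant part, and the rest gives the
    matrix.\<close>
  have affine_zero: "M = 0 \<and> c = d"
    if "\<And>z. z \<in> X_h S \<Longrightarrow> M *v coords S z + c - d = 0"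
    for M :: "real^(('v, 't) xidx)^'m" and c d
  proof -
    have *: "M *v x + c - d = 0" for x
      using that[OF of_coords_in_X_h[OF n, of x]] by (simp add: n)
    from *[of 0] have "c = d" by simp
    with * show ?thesis by (simp add: matrix_eq)
  qed
  have feasible: "A_mat S ** H_mat S = 0 \<and> A_mat S *v k_vec S = b_vec S"
    if "\<forall>z\<in>X_h S. A_mat S *v coords S (P_upd S z) = b_vec S"
    by (rule affine_zero) (use that residual in force)
  have idempotent: "H_mat S ** H_mat S = H_mat S \<and> H_mat S *v k_vec S = 0"
    if "\<forall>z\<in>X_h S. P_upd S (P_upd S z) = P_upd S z"
  proof -
    have "H_mat S ** H_mat S - H_mat S = 0 \<and> H_mat S *v k_vec S = 0"
      by (rule affine_zero) (use that defect in force)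
    then show ?thesis by simp
  qed
  have oblique: "\<exists>H k. A_mat S ** H = 0 \<and> A_mat S *v k = b \<and> H ** H = H \<and> H *v k = 0 \<and>
           \<not> orthogonal_projection_onto (W_h S) (\<lambda>x. H *v x + k) (range (\<lambda>x. H *v x + k)) \<and>
           \<not> orthogonal_projection_onto (W_h S) (\<lambda>x. H *v x + k) {x. A_mat S *v x = b}"
    if "\<exists>x. A_mat S *v x = b" for b
  proof -
    from that obtain x0 where b: "b = A_mat S *v x0" by blast
    obtain v where v: "v \<noteq> 0" "A_mat S *v v = 0" by (rule A_mat_kernel_nontrivial[OF ot])
    have "W_h S *v v \<noteq> 0" using W_h_injective[OF ot] v(1) by blast
    \<comment> \<open>The dimension is three times the number of space-time nodes, which leaves room
      for a direction orthogonal to the kernel vector.\<close>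
    moreover have "2 \<le> CARD(('v, 't) xidx)"
    proof -
      have "0 < CARD('t) * CARD('v)" by simp
      then have "2 \<le> 3 * (CARD('t) * CARD('v))" by linarith
      then show ?thesis by simp
    qed
    ultimately show ?thesis unfolding b by (rule exists_oblique_projection[OF v])
  qed
  show ?thesis using residual defect feasible idempotent oblique by blast
qed

end
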